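(* Let $M$ be an indecomposable $H_\lambda$-module of dimension 3. Then there is a unique pair $(\chi,i)\in\mathcal{O}_1\times\{1,2,3,4\}$ such that $M\simeq M_{3,i}^\chi$. As well, $(M_{3,1}^\chi)^*\simeq M_{3,4}^{\bar\chi}$ and $(M_{3,2}^\chi)^*\simeq M_{3,3}^{-\bar\chi}$.
   Context: $\Bbbk$ is an algebraically closed field of characteristic zero, $N,M\ge2$ are integers (the letter $M$ is also used for modules), $\lambda=(\lambda_1,\lambda_2,\lambda_3)\in\Bbbk^3$, $\Gamma=\langle g_1,g_2: g_1g_2=g_2g_1,\ g_1^{2N}=g_2^{2M}=1\rangle$. $H_\lambda$ is the algebra generated by $\Gamma$ and $a_1,a_2$ with relations $g_1a_1=-a_1g_1$, $g_1a_2=-a_2g_1$, $g_2a_1=a_1g_2$, $g_2a_2=-a_2g_2$, $a_1^2=\lambda_1(1-g_1^2)$, $a_2^2=\lambda_2(1-g_2^2)$, $a_1a_2a_1a_2+a_2a_1a_2a_1=\lambda_3(1-g_1^2g_2^2)-2\lambda_1\lambda_2(1+g_2^2)(1-g_1^2)$. It is a pointed Hopf algebra with $g_i$ group-like and $\Delta(a_i)=a_i\otimes1+g_i\otimes a_i$, so the antipode satisfies $S(g_i)=g_i^{-1}$, $S(a_i)=-g_i^{-1}a_i$; the dual $V^*$ of a module $V$ has action $(h\cdot f)(v)=f(S(h)v)$. $\mathcal{O}=\mathbb{G}_{2N}\times\mathbb{G}_{2M}$ ($\mathbb{G}_n$ = $n$th roots of 1 in $\Bbbk$). For $\chi=(\chi_1,\chi_2)\in\mathcal{O}$: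 a vector $v$ is of type $\chi$ if $g_iv=\chi_iv$; $\bar\chi=(-\chi_1,\chi_2)$, $-\chi=(-\chi_1,-\chi_2)$, $-\bar\chi=(\chi_1,-\chi_2)$. $\mathcal{O}_1$ is the set of $\chi\in\mathcal{O}$ with $\lambda_1(1-\chi_1^2)=0$, $\lambda_2(1-\chi_2^2)=0$ and $\lambda_3(1-\chi_1^2\chi_2^2)-2\lambda_1\lambda_2(1+\chi_2^2)(1-\chi_1^2)=0$. For $\chi\in\mathcal{O}_1$, the following modules have bases among $e_1,e_2,e_3,e_4$ of types $\chi,\bar\chi,-\bar\chi,-\chi$ respectively; actions of $a_1,a_2$ not listed are zero. $M_{3,1}^\chi$: basis $e_1,e_2,e_3$, $a_1e_2=e_1$, $a_2e_3=e_2$. $M_{3,2}^\chi$: basis $e_1,e_2,e_3$, $a_1e_2=e_1$, $a_2e_2=e_3$. $M_{3,3}^\chi$: basis $e_1,e_2,e_4$, $a_1e_2=e_1$, $a_2e_4=e_1$. $M_{3,4}^\chi$: basis $e_1,e_3,e_4$, $a_1e_3=e_4$, $a_2e_4=e_1$.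
   Formalization: The printed duals fail, e.g. for χ=(1,1), by comparing weights; with χ^{-1}=(χ_1^{-1},χ_2^{-1}), what is proved is (M_{3,1}^χ)^* ≃ M_{3,4}^{ψ} for ψ=(χ_1^{-1},-χ_2^{-1}) and (M_{3,2}^χ)^* ≃ M_{3,3}^{ψ'} for ψ'=(-χ_1^{-1},χ_2^{-1}). *)

theory Defs
  imports
    "HOL-Algebra.QuotRing"
    "HOL-Algebra.Module"
    "HOL-Library.Poly_Mapping"
    "HOL-Computational_Algebra.Polynomial"
begin

section \<open>The algebra \<open>H\<^sub>\<lambda>\<close>\<close>

datatype gen = G1 | G2 | A1 | A2

text \<open>The free monoid on the generators, written additively because \<open>'m \<Rightarrow>\<^sub>0 'k\<close>
  carries the convolution product over an additive (not necessarily commutative) monoid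
  \<open>'m\<close>. Thus \<open>word \<Rightarrow>\<^sub>0 'k\<close> is the free associative algebra.\<close>

datatype word = Word (letters: "gen list")

instantiation word :: monoid_add
begin

definition "0 = Word []"
definition "u + v = Word (letters u @ letters v)"

instance
  by standard (simp_all add: zero_word_def plus_word_def)

end

type_synonym 'k free = "word \<Rightarrow>\<^sub>0 'k"

definition const :: "'k::field \<Rightarrow> 'k free" where
  "const c = Poly_Mapping.single 0 c"

definition gen :: "gen \<Rightarrow> 'k::field free" where
  "gen x = Poly_Mapping.single (Word [x]) 1"

definition free_ring :: "'k::field free ring" where
  "free_ring = \<lparr>carrier = UNIV, monoid.mult = (*), one = 1, zero = 0, add = (+)\<rparr>"

definition relators :: "nat \<Rightarrow> nat \<Rightarrow> 'k::field \<Rightarrow> 'k \<Rightarrow> 'k \<Rightarrow> 'k free set" where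
  "relators N M l1 l2 l3 =
    (let g1 = gen G1; g2 = gen G2; a1 = gen A1; a2 = gen A2 in
     {g1 * g2 - g2 * g1, g1 ^ (2 * N) - 1, g2 ^ (2 * M) - 1,
      g1 * a1 + a1 * g1, g1 * a2 + a2 * g1, g2 * a1 - a1 * g2, g2 * a2 + a2 * g2,
      a1 ^ 2 - const l1 * (1 - g1 ^ 2),
      a2 ^ 2 - const l2 * (1 - g2 ^ 2),
      (a1 * a2 * a1 * a2 + a2 * a1 * a2 * a1)
        - (const l3 * (1 - g1 ^ 2 * g2 ^ 2)
           - const (2 * l1 * l2) * (1 + g2 ^ 2) * (1 - g1 ^ 2))})"

definition rel_ideal :: "nat \<Rightarrow> nat \<Rightarrow> 'k::field \<Rightarrow> 'k \<Rightarrow> 'k \<Rightarrow> 'k free set" where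
  "rel_ideal N M l1 l2 l3 = Idl\<^bsub>free_ring\<^esub> (relators N M l1 l2 l3)"

definition H_alg :: "nat \<Rightarrow> nat \<Rightarrow> 'k::field \<Rightarrow> 'k \<Rightarrow> 'k \<Rightarrow> 'k free set ring" where
  "H_alg N M l1 l2 l3 = free_ring Quot (rel_ideal N M l1 l2 l3)"

definition cls :: "nat \<Rightarrow> nat \<Rightarrow> 'k::field \<Rightarrow> 'k \<Rightarrow> 'k \<Rightarrow> 'k free \<Rightarrow> 'k free set" where
  "cls N M l1 l2 l3 p = rel_ideal N M l1 l2 l3 +>\<^bsub>free_ring\<^esub> p"

text \<open>The antipode is the algebra anti-endomorphism of \<open>H\<^sub>\<lambda>\<close> with
  \<open>S(g\<^sub>i) = g\<^sub>i\<^sup>-\<^sup>1\<close> and \<open>S(a\<^sub>i) = - g\<^sub>i\<^sup>-\<^sup>1 a\<^sub>i\<close>, where \<open>g\<^sub>1\<^sup>-\<^sup>1 = g\<^sub>1\<^sup>2\<^sup>N\<^sup>-\<^sup>1\<close> and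
  \<open>g\<^sub>2\<^sup>-\<^sup>1 = g\<^sub>2\<^sup>2\<^sup>M\<^sup>-\<^sup>1\<close>. It is first written on the free algebra and then passed to the
  quotient; the union collapses to a single coset since the ideal is preserved.\<close>

fun antipode_gen :: "nat \<Rightarrow> nat \<Rightarrow> gen \<Rightarrow> 'k::field free" where
  "antipode_gen N M G1 = gen G1 ^ (2 * N - 1)"
| "antipode_gen N M G2 = gen G2 ^ (2 * M - 1)"
| "antipode_gen N M A1 = - (gen G1 ^ (2 * N - 1) * gen A1)"
| "antipode_gen N M A2 = - (gen G2 ^ (2 * M - 1) * gen A2)"

fun antipode_word :: "nat \<Rightarrow> nat \<Rightarrow> gen list \<Rightarrow> 'k::field free" where
  "antipode_word N M [] = 1"
| "antipode_word N M (x # w) = antipode_word N M w * antipode_gen N M x"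

definition antipode_free :: "nat \<Rightarrow> nat \<Rightarrow> 'k::field free \<Rightarrow> 'k free" where
  "antipode_free N M p =
    (\<Sum>w\<in>Poly_Mapping.keys p. const (Poly_Mapping.lookup p w) * antipode_word N M (letters w))"

definition antipode ::
  "nat \<Rightarrow> nat \<Rightarrow> 'k::field \<Rightarrow> 'k \<Rightarrow> 'k \<Rightarrow> 'k free set \<Rightarrow> 'k free set" where
  "antipode N M l1 l2 l3 h = (\<Union>p\<in>h. cls N M l1 l2 l3 (antipode_free N M p))"

section \<open>Modules\<close>

text \<open>The library locale \<open>module\<close> has the same axioms but requires a commutative ring. The
  fields \<open>mult\<close> and \<open>one\<close> of the record \<open>module\<close> play no role.\<close>

locale left_module = R?: ring R + M?: abelian_group M for R (structure) and M (structure) +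
  assumes smult_closed:
      "\<lbrakk>a \<in> carrier R; x \<in> carrier M\<rbrakk> \<Longrightarrow> a \<odot>\<^bsub>M\<^esub> x \<in> carrier M"
    and smult_l_distr:
      "\<lbrakk>a \<in> carrier R; b \<in> carrier R; x \<in> carrier M\<rbrakk> \<Longrightarrow>
        (a \<oplus>\<^bsub>R\<^esub> b) \<odot>\<^bsub>M\<^esub> x = a \<odot>\<^bsub>M\<^esub> x \<oplus>\<^bsub>M\<^esub> b \<odot>\<^bsub>M\<^esub> x"
    and smult_r_distr:
      "\<lbrakk>a \<in> carrier R; x \<in> carrier M; y \<in> carrier M\<rbrakk> \<Longrightarrow>
        a \<odot>\<^bsub>M\<^esub> (x \<oplus>\<^bsub>M\<^esub> y) = a \<odot>\<^bsub>M\<^esub> x \<oplus>\<^bsub>M\<^esub> a \<odot>\<^bsub>M\<^esub> y"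
    and smult_assoc:
      "\<lbrakk>a \<in> carrier R; b \<in> carrier R; x \<in> carrier M\<rbrakk> \<Longrightarrow>
        (a \<otimes>\<^bsub>R\<^esub> b) \<odot>\<^bsub>M\<^esub> x = a \<odot>\<^bsub>M\<^esub> (b \<odot>\<^bsub>M\<^esub> x)"
    and smult_one: "x \<in> carrier M \<Longrightarrow> \<one>\<^bsub>R\<^esub> \<odot>\<^bsub>M\<^esub> x = x"

definition module_iso ::
  "('a, 'c) ring_scheme \<Rightarrow> ('a, 'v) module \<Rightarrow> ('a, 'w) module \<Rightarrow> bool" where
  "module_iso R V W \<longleftrightarrow> left_module R V \<and> left_module R W \<and>
    (\<exists>\<phi>. bij_betw \<phi> (carrier V) (carrier W) \<and>
      (\<forall>x\<in>carrier V. \<forall>y\<in>carrier V. \<phi> (x \<oplus>\<^bsub>V\<^esub> y) = \<phi> x \<oplus>\<^bsub>W\<^esub> \<phi> y) \<and>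
      (\<forall>h\<in>carrier R. \<forall>x\<in>carrier V. \<phi> (h \<odot>\<^bsub>V\<^esub> x) = h \<odot>\<^bsub>W\<^esub> \<phi> x))"

definition indecomposable :: "('a, 'c) ring_scheme \<Rightarrow> ('a, 'v) module \<Rightarrow> bool" where
  "indecomposable R V \<longleftrightarrow>
    carrier V \<noteq> {\<zero>\<^bsub>V\<^esub>} \<and>
    (\<forall>U W. submodule U R V \<and> submodule W R V \<and> U \<inter> W = {\<zero>\<^bsub>V\<^esub>} \<and> U <+>\<^bsub>V\<^esub> W = carrier V
      \<longrightarrow> U = {\<zero>\<^bsub>V\<^esub>} \<or> W = {\<zero>\<^bsub>V\<^esub>})"

text \<open>The \<open>\<bbbk>\<close>-vector space structure of an \<open>H\<^sub>\<lambda>\<close>-module is the restriction of the action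
  along \<open>\<bbbk> \<rightarrow> H\<^sub>\<lambda>\<close>.\<close>

definition scal ::
  "nat \<Rightarrow> nat \<Rightarrow> 'k::field \<Rightarrow> 'k \<Rightarrow> 'k \<Rightarrow> ('k free set, 'v) module \<Rightarrow> 'k \<Rightarrow> 'v \<Rightarrow> 'v" where
  "scal N M l1 l2 l3 V c x = cls N M l1 l2 l3 (const c) \<odot>\<^bsub>V\<^esub> x"

definition has_dim ::
  "nat \<Rightarrow> nat \<Rightarrow> 'k::field \<Rightarrow> 'k \<Rightarrow> 'k \<Rightarrow> ('k free set, 'v) module \<Rightarrow> nat \<Rightarrow> bool" where
  "has_dim N M l1 l2 l3 V n \<longleftrightarrow>
    (\<exists>b\<in>{..<n} \<rightarrow> carrier V. \<forall>x\<in>carrier V.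
      \<exists>!c. c \<in> {..<n} \<rightarrow>\<^sub>E UNIV \<and> x = (\<Oplus>\<^bsub>V\<^esub>i\<in>{..<n}. scal N M l1 l2 l3 V (c i) (b i)))"

definition dual ::
  "nat \<Rightarrow> nat \<Rightarrow> 'k::field \<Rightarrow> 'k \<Rightarrow> 'k \<Rightarrow> ('k free set, 'v) module \<Rightarrow>
    ('k free set, 'v \<Rightarrow> 'k) module" where
  "dual N M l1 l2 l3 V =
    \<lparr>carrier = {f \<in> extensional (carrier V).
        (\<forall>x\<in>carrier V. \<forall>y\<in>carrier V. f (x \<oplus>\<^bsub>V\<^esub> y) = f x + f y) \<and>
        (\<forall>c. \<forall>x\<in>carrier V. f (scal N M l1 l2 l3 V c x) = c * f x)},
     monoid.mult = undefined, one = undefined,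
     zero = (\<lambda>x\<in>carrier V. 0),
     add = (\<lambda>f f'. \<lambda>x\<in>carrier V. f x + f' x),
     module.smult = (\<lambda>h f. \<lambda>x\<in>carrier V. f (antipode N M l1 l2 l3 h \<odot>\<^bsub>V\<^esub> x))\<rparr>"

section \<open>Types of weight vectors\<close>

type_synonym 'k wt = "'k \<times> 'k"

definition O_set :: "nat \<Rightarrow> nat \<Rightarrow> 'k::field wt set" where
  "O_set N M = {\<chi>. fst \<chi> ^ (2 * N) = 1 \<and> snd \<chi> ^ (2 * M) = 1}"

definition O1_set :: "nat \<Rightarrow> nat \<Rightarrow> 'k::field \<Rightarrow> 'k \<Rightarrow> 'k \<Rightarrow> 'k wt set" where
  "O1_set N M l1 l2 l3 = {(x, y) \<in> O_set N M.
      l1 * (1 - x ^ 2) = 0 \<and> l2 * (1 - y ^ 2) = 0 \<and>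
      l3 * (1 - x ^ 2 * y ^ 2) - 2 * l1 * l2 * (1 + y ^ 2) * (1 - x ^ 2) = 0}"

definition wt_bar :: "'k::field wt \<Rightarrow> 'k wt" where
  "wt_bar \<chi> = (- fst \<chi>, snd \<chi>)"

definition wt_neg :: "'k::field wt \<Rightarrow> 'k wt" where
  "wt_neg \<chi> = (- fst \<chi>, - snd \<chi>)"

text \<open>If \<open>v\<close> has type \<open>\<chi>\<close>, the corresponding dual basis vector has type \<open>\<chi>\<^sup>-\<^sup>1\<close>, as
  \<open>S(g\<^sub>i) = g\<^sub>i\<^sup>-\<^sup>1\<close>.\<close>

definition wt_inv :: "'k::field wt \<Rightarrow> 'k wt" where
  "wt_inv \<chi> = (inverse (fst \<chi>), inverse (snd \<chi>))"

section \<open>The modules \<open>M\<^sub>3\<^sub>,\<^sub>i\<^sup>\<chi>\<close>\<close>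

text \<open>Vectors are coordinate functions \<open>nat \<Rightarrow> 'k\<close> supported on the index set of the basis.\<close>

definition basis_vec :: "nat \<Rightarrow> nat \<Rightarrow> 'k::field" where
  "basis_vec j = (\<lambda>k. if k = j then 1 else 0)"

definition basis_set :: "nat \<Rightarrow> nat set" where
  "basis_set i = (if i = 3 then {1, 2, 4} else if i = 4 then {1, 3, 4} else {1, 2, 3})"

definition basis_type :: "'k::field wt \<Rightarrow> nat \<Rightarrow> 'k wt" where
  "basis_type \<chi> j =
    (if j = 1 then \<chi> else if j = 2 then wt_bar \<chi>
     else if j = 3 then wt_neg (wt_bar \<chi>) else wt_neg \<chi>)"

text \<open>\<open>gen_basis \<chi> i x j\<close> is \<open>x\<cdot>e\<^sub>j\<close> in \<open>M\<^sub>3\<^sub>,\<^sub>i\<^sup>\<chi>\<close>.\<close>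

fun gen_basis :: "'k::field wt \<Rightarrow> nat \<Rightarrow> gen \<Rightarrow> nat \<Rightarrow> nat \<Rightarrow> 'k" where
  "gen_basis \<chi> i G1 j = (\<lambda>k. fst (basis_type \<chi> j) * basis_vec j k)"
| "gen_basis \<chi> i G2 j = (\<lambda>k. snd (basis_type \<chi> j) * basis_vec j k)"
| "gen_basis \<chi> i A1 j =
    (if i \<in> {1, 2, 3} \<and> j = 2 then basis_vec 1
     else if i = 4 \<and> j = 3 then basis_vec 4
     else (\<lambda>_. 0))"
| "gen_basis \<chi> i A2 j =
    (if i = 1 \<and> j = 3 then basis_vec 2
     else if i = 2 \<and> j = 2 then basis_vec 3
     else if i \<in> {3, 4} \<and> j = 4 then basis_vec 1
     else (\<lambda>_. 0))"

definition gen_act :: "'k::field wt \<Rightarrow> nat \<Rightarrow> gen \<Rightarrow> (nat \<Rightarrow> 'k) \<Rightarrow> nat \<Rightarrow> 'k" where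
  "gen_act \<chi> i x v = (\<lambda>k. \<Sum>j\<in>basis_set i. v j * gen_basis \<chi> i x j k)"

definition free_act :: "'k::field wt \<Rightarrow> nat \<Rightarrow> 'k free \<Rightarrow> (nat \<Rightarrow> 'k) \<Rightarrow> nat \<Rightarrow> 'k" where
  "free_act \<chi> i p v =
    (\<lambda>k. \<Sum>w\<in>Poly_Mapping.keys p.
      Poly_Mapping.lookup p w * foldr (gen_act \<chi> i) (letters w) v k)"

text \<open>A class in \<open>H\<^sub>\<lambda>\<close> acts through any of its representatives; for \<open>\<chi> \<in> \<O>\<^sub>1\<close> the relators
  act by zero, so that the image below is a singleton.\<close>

definition M3 :: "nat \<Rightarrow> 'k::field wt \<Rightarrow> ('k free set, nat \<Rightarrow> 'k) module" where
  "M3 i \<chi> =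
    \<lparr>carrier = {v. \<forall>j. j \<notin> basis_set i \<longrightarrow> v j = 0},
     monoid.mult = undefined, one = undefined,
     zero = (\<lambda>_. 0),
     add = (\<lambda>u v j. u j + v j),
     module.smult = (\<lambda>h v. the_elem ((\<lambda>p. free_act \<chi> i p v) ` h))\<rparr>"

end

theory Submission
  imports "HOL-Analysis.Cartesian_Space" Defs
begin

text \<open>On an indecomposable module the central elements \<open>g\<^sub>1\<^sup>2\<close> and \<open>g\<^sub>2\<^sup>2\<close>, being of finite order, act by scalars
  \<open>x\<^sup>2\<close> and \<open>y\<^sup>2\<close>, so the module has a basis of vectors of types \<open>(\<plusminus>x, \<plusminus>y)\<close>, and \<open>a\<^sub>1\<close>, \<open>a\<^sub>2\<close> exchange the
  two eigenspaces of \<open>g\<^sub>1\<close>. In dimension 3 one eigenspace is larger than the other, so every operator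
  anticommuting with \<open>g\<^sub>1\<close> has a nonzero kernel vector. For \<open>a\<^sub>1\<close> and \<open>a\<^sub>2\<close> this forces
  \<open>a\<^sub>1\<^sup>2 = a\<^sub>2\<^sup>2 = 0\<close>, and then for \<open>a\<^sub>1 + a\<^sub>2\<close>, whose fourth power is \<open>a\<^sub>1a\<^sub>2a\<^sub>1a\<^sub>2 + a\<^sub>2a\<^sub>1a\<^sub>2a\<^sub>1\<close>, it forces
  the last condition defining \<open>\<O>\<^sub>1\<close>. If the larger eigenspace is spanned by homogeneous \<open>u\<close>, \<open>v\<close> and the
  smaller one by \<open>w\<close>, then \<open>a\<^sub>1\<close> and \<open>a\<^sub>2\<close> only move \<open>w\<close> to \<open>u\<close> or \<open>v\<close> and back, and unless a line splits
  off, \<open>u\<close> and \<open>v\<close> have different types and the four possible directions of the two arrows give the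
  four modules. The duals are identified by explicit pairings.\<close>

section \<open>The free algebra and its quotient\<close>

text \<open>Elements of the quotient algebra are handled through words: a statement stable under
  sums and products is checked on constants and generators only, and a module of dimension 3 is
  replaced by four operators on \<open>'k ^ 3\<close>. There indecomposability is used at two
  points: an eigenspace of a central operator of finite order is a direct summand, and no line of a
  homogeneous basis may split off. Only the squares of \<open>x\<close> and \<open>y\<close> are
  determined by the module, so their signs stay free and are fixed by the eigenspace that happens to
  be larger. Uniqueness of the pair rests on an invariant that is visible without coordinates, the
  types of the images of the two odd generators. In a dual the arrows are reversed and the types
  inverted. The path a2, a1 of the first module becomes the path a1, a2 of the fourth; the source of
  two arrows in the second becomes the sink of two arrows in the third. The parameter of the dual is
  the inverse of the type of the vector whose dual takes the place of e1.\<close>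

lemma ring_free_ring: "ring (free_ring :: 'k::field free ring)"
proof (rule ringI)
  show "abelian_group (free_ring :: 'k free ring)"
    by (rule abelian_groupI) (auto simp: free_ring_def algebra_simps intro: exI[of _ "- _"])
  show "Group.monoid (free_ring :: 'k free ring)"
    by (rule monoidI) (auto simp: free_ring_def algebra_simps)
qed (auto simp: free_ring_def algebra_simps)

lemma const_0: "const 0 = (0 :: 'k::field free)"
  by (simp add: const_def)

lemma const_1: "const 1 = (1 :: 'k::field free)"
  by (simp add: const_def)

lemma const_add: "const (a + b) = const a + (const b :: 'k::field free)"
  by (simp add: const_def single_add)

lemma const_mult: "const (a * b) = const a * (const b :: 'k::field free)"
  by (simp add: const_def mult_single)

lemma const_times_single: "const c * Poly_Mapping.single w a = Poly_Mapping.single w (c * a :: 'k::field)"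
  by (simp add: const_def mult_single)

lemma single_Word_eq: "Poly_Mapping.single (Word xs) (1::'k::field) = prod_list (map gen xs)"
proof (induction xs)
  case Nil
  then show ?case by (simp add: zero_word_def[symmetric])
next
  case (Cons x xs)
  have "Poly_Mapping.single (Word (x # xs)) (1::'k) = gen x * Poly_Mapping.single (Word xs) 1"
    by (simp add: gen_def mult_single plus_word_def)
  then show ?case using Cons by simp
qed

lemma free_single_induct [case_names single add]:
  fixes p :: "'k::field free"
  assumes "\<And>w c. P (Poly_Mapping.single w c)" and "\<And>p q. P p \<Longrightarrow> P q \<Longrightarrow> P (p + q)"
  shows "P p"
proof -
  have p: "p = (\<Sum>w\<in>Poly_Mapping.keys p. Poly_Mapping.single w (Poly_Mapping.lookup p w))"
    by (rule poly_mapping_eqI) (simp add: lookup_sum lookup_single when_def in_keys_iff)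
  have "P (\<Sum>w\<in>A. Poly_Mapping.single w (f w))" if "finite A" for A and f :: "word \<Rightarrow> 'k"
    using that
  proof (induction A rule: finite_induct)
    case empty
    \<comment> \<open>The empty sum is itself a monomial, with coefficient zero.\<close>
    then show ?case using assms(1)[of 0 0] by simp
  qed (simp add: assms)
  then show ?thesis by (subst p) simp
qed

text \<open>Monomials are products of generators up to a constant. Negatives need no case of their
  own, since -1 is a constant.\<close>

lemma free_induct [case_names const gen add mult]:
  fixes p :: "'k::field free"
  assumes "\<And>c. P (const c)" and "\<And>x. P (gen x)"
    and "\<And>p q. P p \<Longrightarrow> P q \<Longrightarrow> P (p + q)" and "\<And>p q. P p \<Longrightarrow> P q \<Longrightarrow> P (p * q)"
  shows "P p"
proof (induction p rule: free_single_induct)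
  case (single w c)
  obtain xs where w: "w = Word xs" by (cases w)
  have "P (prod_list (map gen xs))"
    by (induction xs) (use assms(1)[of 1] in \<open>auto simp: const_1 assms\<close>)
  moreover have "Poly_Mapping.single w c = const c * prod_list (map gen xs)"
    by (simp add: w single_Word_eq[symmetric] const_times_single)
  ultimately show ?case using assms by simp
qed (rule assms)

lemma const_commutes: "const c * p = p * (const c :: 'k::field free)"
  by (induction p rule: free_single_induct) (simp_all add: const_def mult_single mult.commute distrib_left distrib_right)

lemma relators_carrier: "relators N M l1 l2 l3 \<subseteq> carrier free_ring"
  by (simp add: free_ring_def)

lemma ideal_rel_ideal: "ideal (rel_ideal N M l1 l2 l3) free_ring"
  unfolding rel_ideal_def by (rule ring.genideal_ideal[OF ring_free_ring relators_carrier])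

lemma relators_rel_ideal: "r \<in> relators N M l1 l2 l3 \<Longrightarrow> r \<in> rel_ideal N M l1 l2 l3"
  unfolding rel_ideal_def using ring.genideal_self[OF ring_free_ring relators_carrier] by blast

lemma zero_mem_rel: "0 \<in> rel_ideal N M l1 l2 l3"
  using additive_subgroup.zero_closed[OF ideal.axioms(1)[OF ideal_rel_ideal[of N M l1 l2 l3]]]
  by (simp add: free_ring_def)

lemma rel_ideal_minimal:
  assumes "ideal I free_ring" "relators N M l1 l2 l3 \<subseteq> I"
  shows "rel_ideal N M l1 l2 l3 \<subseteq> I"
  unfolding rel_ideal_def by (rule ring.genideal_minimal[OF ring_free_ring assms])

lemma ring_H_alg: "ring (H_alg N M l1 l2 l3)"
  unfolding H_alg_def by (rule ideal.quotient_is_ring[OF ideal_rel_ideal])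

lemma cls_hom: "cls N M l1 l2 l3 \<in> ring_hom free_ring (H_alg N M l1 l2 l3)"
  unfolding H_alg_def cls_def[abs_def] by (rule ideal.rcos_ring_hom[OF ideal_rel_ideal])

lemma carrier_H_alg: "carrier (H_alg N M l1 l2 l3) = range (cls N M l1 l2 l3)"
  by (auto simp: H_alg_def FactRing_def A_RCOSETS_def' cls_def free_ring_def)

lemma cls_closed: "cls N M l1 l2 l3 p \<in> carrier (H_alg N M l1 l2 l3)"
  by (simp add: carrier_H_alg)

lemma cls_add: "cls N M l1 l2 l3 (p + q) =
    cls N M l1 l2 l3 p \<oplus>\<^bsub>H_alg N M l1 l2 l3\<^esub> cls N M l1 l2 l3 q"
  using ring_hom_add[OF cls_hom, of p q N M l1 l2 l3] by (simp add: free_ring_def)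

lemma cls_mult: "cls N M l1 l2 l3 (p * q) =
    cls N M l1 l2 l3 p \<otimes>\<^bsub>H_alg N M l1 l2 l3\<^esub> cls N M l1 l2 l3 q"
  using ring_hom_mult[OF cls_hom, of p q N M l1 l2 l3] by (simp add: free_ring_def)

lemma cls_one: "cls N M l1 l2 l3 1 = \<one>\<^bsub>H_alg N M l1 l2 l3\<^esub>"
  using ring_hom_one[OF cls_hom, of N M l1 l2 l3] by (simp add: free_ring_def)

lemma cls_zero: "p \<in> rel_ideal N M l1 l2 l3 \<Longrightarrow> cls N M l1 l2 l3 p = \<zero>\<^bsub>H_alg N M l1 l2 l3\<^esub>"
  using abelian_subgroup.a_rcos_const[OF abelian_subgroupI3[OF ideal.axioms(1)[OF ideal_rel_ideal] ring.is_abelian_group[OF ring_free_ring]]]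
  by (simp add: cls_def H_alg_def FactRing_def)

lemma mem_cls: "q \<in> cls N M l1 l2 l3 p \<longleftrightarrow> q - p \<in> rel_ideal N M l1 l2 l3"
proof -
  show ?thesis
    by (auto simp: cls_def a_r_coset_def' free_ring_def intro: bexI[of _ "q - p"])
qed

section \<open>Modules over the quotient algebra\<close>

locale H_module = left_module "H_alg N M l1 l2 l3" V
  for N M :: nat and l1 l2 l3 :: "'k::field" and V :: "('k free set, 'v) module" (structure)
begin

text \<open>The action pulled back to the free algebra, so that calculations are done with words and
  not with cosets.\<close>

definition act :: "'k free \<Rightarrow> 'v \<Rightarrow> 'v" where
  "act p x = cls N M l1 l2 l3 p \<odot> x"

abbreviation sc :: "'k \<Rightarrow> 'v \<Rightarrow> 'v" where
  "sc \<equiv> scal N M l1 l2 l3 V"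

lemma sc_act: "sc c x = act (const c) x"
  by (simp add: scal_def act_def)

lemma act_closed [simp, intro]: "x \<in> carrier V \<Longrightarrow> act p x \<in> carrier V"
  by (simp add: act_def smult_closed cls_closed)

lemma sc_closed [simp, intro]: "x \<in> carrier V \<Longrightarrow> sc c x \<in> carrier V"
  by (simp add: sc_act)

lemma act_add: "x \<in> carrier V \<Longrightarrow> act (p + q) x = act p x \<oplus> act q x"
  by (simp add: act_def cls_add smult_l_distr cls_closed)

lemma act_mult: "x \<in> carrier V \<Longrightarrow> act (p * q) x = act p (act q x)"
  by (simp add: act_def cls_mult smult_assoc cls_closed)

lemma act_one: "x \<in> carrier V \<Longrightarrow> act 1 x = x"
  by (simp add: act_def cls_one smult_one)

lemma act_add_right: "x \<in> carrier V \<Longrightarrow> y \<in> carrier V \<Longrightarrow> act p (x \<oplus> y) = act p x \<oplus> act p y"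
  by (simp add: act_def smult_r_distr cls_closed)

lemma act_rel:
  assumes "p \<in> rel_ideal N M l1 l2 l3" and "x \<in> carrier V"
  shows "act p x = \<zero>"
proof -
  have "\<zero>\<^bsub>H_alg N M l1 l2 l3\<^esub> \<odot> x \<oplus> \<zero>\<^bsub>H_alg N M l1 l2 l3\<^esub> \<odot> x = \<zero>\<^bsub>H_alg N M l1 l2 l3\<^esub> \<odot> x"
    using smult_l_distr[of "\<zero>\<^bsub>H_alg N M l1 l2 l3\<^esub>" "\<zero>\<^bsub>H_alg N M l1 l2 l3\<^esub>" x] assms(2) by simp
  then have "\<zero>\<^bsub>H_alg N M l1 l2 l3\<^esub> \<odot> x = \<zero>"
    using assms(2) by (simp add: smult_closed)
  then show ?thesis
    using assms(1) by (simp add: act_def cls_zero)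
qed

lemma act_zero: "x \<in> carrier V \<Longrightarrow> act 0 x = \<zero>"
  by (rule act_rel[OF zero_mem_rel])

lemma act_minus: "x \<in> carrier V \<Longrightarrow> act (- p) x = \<ominus> act p x"
  using act_add[of x "- p" p] by (simp add: act_zero minus_equality)

lemma sc_add: "x \<in> carrier V \<Longrightarrow> sc (a + b) x = sc a x \<oplus> sc b x"
  by (simp add: sc_act const_add act_add)

lemma sc_add_right: "x \<in> carrier V \<Longrightarrow> y \<in> carrier V \<Longrightarrow> sc a (x \<oplus> y) = sc a x \<oplus> sc a y"
  by (simp add: sc_act act_add_right)

lemma sc_sc: "x \<in> carrier V \<Longrightarrow> sc a (sc b x) = sc (a * b) x"
  by (simp add: sc_act const_mult act_mult)

lemma sc_zero: "x \<in> carrier V \<Longrightarrow> sc 0 x = \<zero>"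
  by (simp add: sc_act const_0 act_zero)

lemma sc_one: "x \<in> carrier V \<Longrightarrow> sc 1 x = x"
  by (simp add: sc_act const_1 act_one)

lemma act_sc: "x \<in> carrier V \<Longrightarrow> act p (sc c x) = sc c (act p x)"
  by (simp add: sc_act act_mult[symmetric] const_commutes)

lemma sc_zero_right: "sc c \<zero> = \<zero>"
  using sc_sc[of "\<zero>" c 0] by (simp add: sc_zero)

text \<open>A nonzero difference \<open>a - b\<close> would be invertible and yet kill
  \<open>x\<close>. This makes the type of a nonzero vector unique.\<close>

lemma sc_cancel:
  assumes "x \<in> carrier V" "x \<noteq> \<zero>" "sc a x = sc b x"
  shows "a = b"
proof (rule ccontr)
  assume "a \<noteq> b"
  have "sc (a - b) x \<oplus> sc b x = \<zero> \<oplus> sc b x"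
    using sc_add[of x "a - b" b] assms by simp
  then have "sc (a - b) x = \<zero>"
    using assms(1) by (metis add.right_cancel sc_closed zero_closed)
  then have "sc (inverse (a - b)) (sc (a - b) x) = sc (inverse (a - b)) (sc 0 x)"
    using assms(1) by (simp add: sc_zero)
  then show False
    using \<open>a \<noteq> b\<close> assms(1,2) by (simp add: sc_sc sc_zero sc_zero_right sc_one)
qed

text \<open>Stability under constants and generators passes to sums and products, hence to the whole
  algebra; stability under negation is the action of -1.\<close>

lemma submoduleI_gen:
  assumes "U \<subseteq> carrier V" "\<zero> \<in> U"
    and add: "\<And>x y. x \<in> U \<Longrightarrow> y \<in> U \<Longrightarrow> x \<oplus> y \<in> U"
    and sc: "\<And>c x. x \<in> U \<Longrightarrow> sc c x \<in> U"
    and gen: "\<And>g x. x \<in> U \<Longrightarrow> act (gen g) x \<in> U"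
  shows "submodule U (H_alg N M l1 l2 l3) V"
proof -
  have act: "act p x \<in> U" if "x \<in> U" for p x
    using that
  proof (induction p arbitrary: x rule: free_induct)
    case (const c)
    then show ?case using sc by (simp add: sc_act)
  next
    case (mult p q)
    then show ?case using assms(1) by (metis act_mult subsetD)
  next
    case (add p q)
    then show ?case using assms(1) assms(3) by (metis act_add subsetD)
  qed (rule gen)
  have neg: "\<ominus> x \<in> U" if "x \<in> U" for x
    using act[OF that, of "- 1"] that assms(1) by (metis act_minus act_one subsetD)
  show ?thesis
  proof (intro submodule.intro submodule_axioms.intro)
    show "subgroup U (add_monoid V)"
      by (intro subgroup.intro) (use assms neg in \<open>auto simp: a_inv_def\<close>)
  qed (use act in \<open>auto simp: carrier_H_alg act_def\<close>)
qed

text \<open>Existence and uniqueness of coefficients in \<open>has_dim\<close> are surjectivity and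
  injectivity of the linear combination map. It moves the problem to a type where vector space
  theory applies.\<close>

lemma coordinates_3:
  assumes "has_dim N M l1 l2 l3 V 3"
  obtains \<Lambda> :: "'k ^ 3 \<Rightarrow> 'v" where "bij_betw \<Lambda> UNIV (carrier V)"
    "\<And>u v. \<Lambda> (u + v) = \<Lambda> u \<oplus> \<Lambda> v" "\<And>c v. \<Lambda> (c *s v) = sc c (\<Lambda> v)"
proof -
  obtain b :: "nat \<Rightarrow> 'v" where b: "b \<in> {..<3} \<rightarrow> carrier V"
    and "\<forall>x\<in>carrier V. \<exists>!c. c \<in> {..<3} \<rightarrow>\<^sub>E UNIV \<and> x = (\<Oplus>i\<in>{..<3::nat}. sc (c i) (b i))"
    using assms[unfolded has_dim_def] by (elim bexE)
  then have ex: "\<And>x. x \<in> carrier V \<Longrightarrow> \<exists>!c. c \<in> {..<3} \<rightarrow>\<^sub>E UNIV \<and> x = (\<Oplus>i\<in>{..<3::nat}. sc (c i) (b i))"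
    by simp
  define \<Lambda> :: "'k ^ 3 \<Rightarrow> 'v" where
    "\<Lambda> v = sc (v $ 1) (b 0) \<oplus> (sc (v $ 2) (b 1) \<oplus> sc (v $ 3) (b 2))" for v
  have bs [simp]: "b 0 \<in> carrier V" "b 1 \<in> carrier V" "b (Suc 0) \<in> carrier V" "b 2 \<in> carrier V"
    using b by auto
  have 3: "{..<3} = {0, 1, 2::nat}" by auto
  have fs: "(\<Oplus>i\<in>{..<3::nat}. sc (c i) (b i)) = sc (c 0) (b 0) \<oplus> (sc (c 1) (b 1) \<oplus> sc (c 2) (b 2))" for c
    by (simp add: 3)
  \<comment> \<open>Coordinates carry the indices 1, 2, 3 and the vectors \<open>b\<close> the
    indices 0, 1, 2. The restriction makes \<open>e v\<close> extensional, as the uniqueness in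
    \<open>has_dim\<close> requires.\<close>
  define e where "e v = (\<lambda>i\<in>{..<3::nat}. v $ (if i = 0 then 1 else if i = 1 then 2 else 3))" for v :: "'k^3"
  have \<Lambda>e: "\<Lambda> v = (\<Oplus>i\<in>{..<3::nat}. sc (e v i) (b i))" for v
    unfolding fs by (simp add: \<Lambda>_def e_def)
  have \<Lambda>c: "\<Lambda> v \<in> carrier V" for v by (simp add: \<Lambda>_def)
  have e_in: "e v \<in> {..<3} \<rightarrow>\<^sub>E UNIV" for v by (simp add: e_def)
  have "inj \<Lambda>"
  proof (rule injI)
    fix u v assume "\<Lambda> u = \<Lambda> v"
    then have "e u = e v"
      using ex[OF \<Lambda>c[of u]] e_in \<Lambda>e by metis
    then have "e u 0 = e v 0" "e u 1 = e v 1" "e u 2 = e v 2" by simp_all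
    then show "u = v" by (simp add: e_def vec_eq_iff forall_3)
  qed
  moreover have "\<exists>v. \<Lambda> v = x" if x: "x \<in> carrier V" for x
  proof -
    obtain c where "x = (\<Oplus>i\<in>{..<3::nat}. sc (c i) (b i))" using ex[OF x] by blast
    then have "\<Lambda> (vector [c 0, c 1, c 2]) = x" unfolding fs by (simp add: \<Lambda>_def)
    then show ?thesis by blast
  qed
  ultimately have "bij_betw \<Lambda> UNIV (carrier V)"
    using \<Lambda>c by (force simp: bij_betw_def)
  moreover have "\<Lambda> (u + v) = \<Lambda> u \<oplus> \<Lambda> v" for u v
    by (simp add: \<Lambda>_def sc_add a_ac)
  moreover have "\<Lambda> (c *s v) = sc c (\<Lambda> v)" for c v
    by (simp add: \<Lambda>_def sc_add_right sc_sc)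
  ultimately show ?thesis using that by blast
qed

end

unbundle no vec_syntax \<comment> \<open>it makes \<open>\<chi>\<close> a binder\<close>

section \<open>Linear algebra in dimension three\<close>

text \<open>The vector p(Z) v, computed by Horner's scheme.\<close>

definition pact :: "('k::field ^ 'n \<Rightarrow> 'k ^ 'n) \<Rightarrow> 'k poly \<Rightarrow> 'k ^ 'n \<Rightarrow> 'k ^ 'n" where
  "pact Z p v = fold_coeffs (\<lambda>a w. a *s v + Z w) p 0"

lemma pact_0: "pact Z 0 v = 0"
  by (simp add: pact_def)

context
  fixes Z :: "'k::field ^ 'n \<Rightarrow> 'k ^ 'n"
  assumes add: "\<And>u v. Z (u + v) = Z u + Z v" and scale: "\<And>c v. Z (c *s v) = c *s Z v"
begin

lemma Z_zero: "Z 0 = 0"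
  using scale[of 0 0] by simp

lemma pact_pCons: "pact Z (pCons a p) v = a *s v + Z (pact Z p v)"
  by (cases "a = 0 \<and> p = 0") (auto simp: pact_def Z_zero)

lemma pact_add: "pact Z (p + q) v = pact Z p v + pact Z q v"
  by (induction p q rule: poly_induct2)
    (auto simp: pact_0 pact_pCons add vec.scale_left_distrib algebra_simps)

lemma pact_smult: "pact Z (smult c p) v = c *s pact Z p v"
  by (induction p) (auto simp: pact_0 pact_pCons scale vec.scale_right_distrib)

lemma pact_linear_factor: "pact Z ([:- c, 1:] * q) v = Z (pact Z q v) - c *s pact Z q v"
proof -
  have "[:- c, 1:] * q = smult (- c) q + pCons 0 q"
    by simp
  then show ?thesis
    by (simp only: pact_add pact_smult pact_pCons) simp
qed

lemma pact_monom: "pact Z (monom 1 n) v = (Z ^^ n) v"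
  by (induction n) (auto simp: monom_Suc monom_0 pact_pCons pact_0 Z_zero)

end

text \<open>Split off a root: p = (X - c) q. Either q(Z) v is nonzero, and then it is an eigenvector
  for c, or q is an annihilating polynomial of smaller degree.\<close>

lemma eigenvector_of_annihilating_poly:
  fixes Z :: "'k::alg_closed_field ^ 'n \<Rightarrow> 'k ^ 'n"
  assumes add: "\<And>u v. Z (u + v) = Z u + Z v" and scale: "\<And>c v. Z (c *s v) = c *s Z v"
    and "p \<noteq> 0" "pact Z p v = 0" "v \<noteq> 0"
  shows "\<exists>c u. u \<noteq> 0 \<and> Z u = c *s u"
  using assms(3-4)
proof (induction "degree p" arbitrary: p rule: less_induct)
  case less
  note lin = add scale
  show ?case
  proof (cases "degree p = 0")
    case True
    then obtain a where "p = [:a:]" by (metis degree_eq_zeroE)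
    then show ?thesis
      using less.prems \<open>v \<noteq> 0\<close> by (simp add: pact_pCons[OF lin] pact_0 Z_zero[OF lin])
  next
    case False
    then obtain c where "poly p c = 0"
      using alg_closed_imp_poly_has_root[of p] by auto
    then obtain q where q: "p = [:- c, 1:] * q"
      by (metis dvdE poly_eq_0_iff_dvd)
    then have "q \<noteq> 0" "degree p = Suc (degree q)"
      using less.prems by (auto simp: degree_mult_eq simp del: mult_pCons_left)
    then show ?thesis
      using less.hyps[of q] less.prems(2) unfolding q
      by (cases "pact Z q v = 0") (auto simp: pact_linear_factor[OF lin] simp del: mult_pCons_left)
  qed
qed

text \<open>The polynomial X^n - 1 annihilates every vector, in particular a coordinate vector,
  which is nonzero.\<close>

lemma finite_order_eigenvector:
  fixes Z :: "'k::alg_closed_field ^ 'n \<Rightarrow> 'k ^ 'n"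
  assumes lin: "\<And>u v. Z (u + v) = Z u + Z v" "\<And>c v. Z (c *s v) = c *s Z v"
    and "n > 0" "\<And>v. (Z ^^ n) v = v"
  shows "\<exists>c u. u \<noteq> 0 \<and> Z u = c *s u"
proof -
  have "monom 1 n + [:- 1:] \<noteq> (0 :: 'k poly)"
  proof
    assume "monom 1 n + [:- 1:] = (0 :: 'k poly)"
    then have "coeff (monom 1 n + [:- 1:]) n = (0 :: 'k)" by simp
    then show False using \<open>n > 0\<close> by (cases n) auto
  qed
  moreover have "pact Z (monom 1 n + [:- 1:]) (axis undefined 1) = 0"
    by (simp add: pact_add[OF lin] pact_monom[OF lin] assms(4) pact_pCons[OF lin] pact_0 Z_zero[OF lin])
  ultimately show ?thesis
    using eigenvector_of_annihilating_poly[OF lin] by (metis axis_eq_0_iff zero_neq_one)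
qed

section \<open>Ordered bases of \<open>'k ^ 3\<close> and changes of basis\<close>

definition basis3 :: "'k::field ^ 3 \<Rightarrow> 'k ^ 3 \<Rightarrow> 'k ^ 3 \<Rightarrow> bool" where
  "basis3 u v w \<longleftrightarrow> (\<forall>z. \<exists>a b c. z = a *s u + b *s v + c *s w) \<and>
    (\<forall>a b c. a *s u + b *s v + c *s w = 0 \<longrightarrow> a = 0 \<and> b = 0 \<and> c = 0)"

lemma basis3_ex: "basis3 u v w \<Longrightarrow> \<exists>a b c. z = a *s u + b *s v + c *s w"
  by (simp add: basis3_def)

lemma basis3_zero: "basis3 u v w \<Longrightarrow> a *s u + b *s v + c *s w = 0 \<Longrightarrow> a = 0 \<and> b = 0 \<and> c = 0"
  by (simp add: basis3_def)

lemma basis3_eq: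
  assumes "basis3 u v w" "a *s u + b *s v + c *s w = a' *s u + b' *s v + c' *s w"
  shows "a = a' \<and> b = b' \<and> c = c'"
proof -
  have "(a - a') *s u + (b - b') *s v + (c - c') *s w = 0"
    using assms(2) by (simp add: vec_eq_iff algebra_simps)
  then show ?thesis using basis3_zero[OF assms(1)] by force
qed

lemma basis3_swap12: "basis3 u v w \<Longrightarrow> basis3 v u w"
  unfolding basis3_def by (metis add.commute)

lemma basis3_swap23:
  assumes "basis3 u v w"
  shows "basis3 u w v"
proof -
  have "a *s u + b *s w + c *s v = a *s u + c *s v + b *s w" for a b c
    by (simp add: ac_simps)
  then show ?thesis using assms unfolding basis3_def by metis
qed

lemma basis3_replace:
  assumes "basis3 u v w" "p \<noteq> 0"
  shows "basis3 (p *s u + q *s v + r *s w) v w"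
  unfolding basis3_def
proof (intro conjI allI impI)
  fix z
  obtain a b c where "z = a *s u + b *s v + c *s w" using basis3_ex[OF assms(1)] by blast
  then have "z = (a / p) *s (p *s u + q *s v + r *s w) + (b - a / p * q) *s v + (c - a / p * r) *s w"
    using assms(2) by (simp add: vec_eq_iff field_simps)
  then show "\<exists>a b c. z = a *s (p *s u + q *s v + r *s w) + b *s v + c *s w" by blast
next
  fix a b c assume "a *s (p *s u + q *s v + r *s w) + b *s v + c *s w = 0"
  then have "(a * p) *s u + (a * q + b) *s v + (a * r + c) *s w = 0"
    by (simp add: vec_eq_iff algebra_simps)
  from basis3_zero[OF assms(1) this] assms(2)
  show "a = 0" "b = 0" "c = 0" by auto
qed

lemma basis3_nonzero: "basis3 u v w \<Longrightarrow> u \<noteq> 0"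
  using basis3_zero[of u v w 1 0 0] by auto

text \<open>Meant for the set of homogeneous vectors: once they span, a whole basis can be chosen
  among them.\<close>

lemma spanning_set_basis3:
  fixes S :: "('k::field ^ 3) set"
  assumes "vec.span S = UNIV"
  obtains u v w where "u \<in> S" "v \<in> S" "w \<in> S" "basis3 u v w"
proof -
  obtain B where B: "B \<subseteq> S" "vec.independent B" "S \<subseteq> vec.span B"
    by (rule vec.maximal_independent_subset)
  have span: "vec.span B = UNIV"
    using assms B(3) vec.span_minimal[OF B(3)] by auto
  have "card B = 3"
    using vec.basis_card_eq_dim[of B UNIV] B(2) span
    by (simp add: card_cart_basis)
  then obtain u v w where uvw: "B = {u, v, w}" "u \<noteq> v" "v \<noteq> w" "u \<noteq> w"
    by (auto simp: card_3_iff)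
  have sum: "(\<Sum>z\<in>B. f z *s z) = f u *s u + f v *s v + f w *s w" for f
    using uvw by (simp add: ac_simps)
  have fin: "finite B" by (simp add: uvw)
  have "basis3 u v w"
    unfolding basis3_def
  proof (intro conjI allI impI)
    fix z
    have "z \<in> range (\<lambda>f. \<Sum>z\<in>B. f z *s z)"
      using span vec.span_finite[OF fin] by auto
    then show "\<exists>a b c. z = a *s u + b *s v + c *s w" unfolding sum by blast
  next
    fix a b c assume 0: "a *s u + b *s v + c *s w = 0"
    define f where "f = (\<lambda>z. if z = u then a else if z = v then b else c)"
    have f: "f u = a" "f v = b" "f w = c" using uvw by (auto simp: f_def)
    have "(\<Sum>z\<in>B. f z *s z) = 0" unfolding sum f by (rule 0)
    then have "\<forall>z\<in>B. f z = 0"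
      using B(2) vec.dependent_finite[OF fin] by blast
    then show "a = 0" "b = 0" "c = 0" using f uvw(1) by auto
  qed
  then show ?thesis using that B(1) uvw(1) by auto
qed

text \<open>The domain is the carrier of a module \<open>M3\<close>, whose vectors are coordinate
  functions supported on three indices.\<close>

lemma basis3_coordinates:
  assumes "basis3 (e a) (e b) (e c)" and "distinct [a, b, c]"
  shows "bij_betw (\<lambda>v. \<Sum>j\<in>{a, b, c}. v j *s e j) {v. \<forall>j. j \<notin> {a, b, c} \<longrightarrow> v j = 0} UNIV"
proof -
  have sum: "(\<Sum>j\<in>{a, b, c}. v j *s e j) = v a *s e a + v b *s e b + v c *s e c" for v
    using assms(2) by (simp add: ac_simps)
  show ?thesis
    unfolding bij_betw_def sum
  proof (intro conjI inj_onI)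
    fix v v' :: "'b \<Rightarrow> 'a"
    assume *: "v \<in> {v. \<forall>j. j \<notin> {a, b, c} \<longrightarrow> v j = 0}" "v' \<in> {v. \<forall>j. j \<notin> {a, b, c} \<longrightarrow> v j = 0}"
      "v a *s e a + v b *s e b + v c *s e c = v' a *s e a + v' b *s e b + v' c *s e c"
    from basis3_eq[OF assms(1) *(3)] *(1,2) show "v = v'"
      by (auto simp: fun_eq_iff) metis
  next
    have "z \<in> (\<lambda>v. v a *s e a + v b *s e b + v c *s e c) ` {v. \<forall>j. j \<notin> {a, b, c} \<longrightarrow> v j = 0}" for z
    proof -
      obtain p q r where "z = p *s e a + q *s e b + r *s e c" using basis3_ex[OF assms(1)] by blast
      then show ?thesis
        using assms(2)
        by (intro image_eqI[of _ _ "\<lambda>j. if j = a then p else if j = b then q else if j = c then r else 0"]) auto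
    qed
    then show "(\<lambda>v. v a *s e a + v b *s e b + v c *s e c) ` {v. \<forall>j. j \<notin> {a, b, c} \<longrightarrow> v j = 0} = UNIV"
      by auto
  qed
qed

section \<open>Indecomposable representations in coordinates\<close>

locale rep3 =
  fixes T :: "gen \<Rightarrow> 'k::{alg_closed_field, field_char_0} ^ 3 \<Rightarrow> 'k ^ 3"
    and N M :: nat and l1 l2 l3 :: 'k
  assumes add: "T g (u + v) = T g u + T g v"
    and scale: "T g (c *s v) = c *s T g v"
    and g1_g2: "T G1 (T G2 v) = T G2 (T G1 v)"
    and g1_pow: "(T G1 ^^ (2 * N)) v = v"
    and g2_pow: "(T G2 ^^ (2 * M)) v = v"
    and g1_a1: "T G1 (T A1 v) = - T A1 (T G1 v)"
    and g1_a2: "T G1 (T A2 v) = - T A2 (T G1 v)"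
    and g2_a1: "T G2 (T A1 v) = T A1 (T G2 v)"
    and g2_a2: "T G2 (T A2 v) = - T A2 (T G2 v)"
    and a1_a1: "T A1 (T A1 v) = l1 *s (v - T G1 (T G1 v))"
    and a2_a2: "T A2 (T A2 v) = l2 *s (v - T G2 (T G2 v))"
    \<comment> \<open>The last bracket is (1 + g2^2)(1 - g1^2) applied to \<open>v\<close>, with the
      first factor multiplied out.\<close>
    and a1_a2: "T A1 (T A2 (T A1 (T A2 v))) + T A2 (T A1 (T A2 (T A1 v))) =
        l3 *s (v - T G1 (T G1 (T G2 (T G2 v))))
        - (2 * l1 * l2) *s (v - T G1 (T G1 v) + T G2 (T G2 (v - T G1 (T G1 v))))"
    and indec: "\<lbrakk>vec.subspace U; vec.subspace W; \<And>g u. u \<in> U \<Longrightarrow> T g u \<in> U;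
        \<And>g w. w \<in> W \<Longrightarrow> T g w \<in> W; U \<inter> W = {0}; \<And>z. \<exists>u\<in>U. \<exists>w\<in>W. z = u + w\<rbrakk>
      \<Longrightarrow> U = {0} \<or> W = {0}"
    and N_pos: "N > 0" and M_pos: "M > 0"
begin

lemma zero [simp]: "T g 0 = 0"
  using scale[of g 0 0] by simp

lemma minus [simp]: "T g (- v) = - T g v"
  using scale[of g "-1" v] by simp

lemma diff: "T g (u - v) = T g u - T g v"
  using add[of g u "- v"] by simp

text \<open>The line of \<open>u\<close> and the plane of \<open>v\<close> and \<open>w\<close>
  would be complementary submodules, both nonzero.\<close>

lemma no_invariant_line:
  assumes b: "basis3 u v w" and "\<And>g. \<exists>c. T g u = c *s u"
    and "\<And>g. \<exists>b c. T g v = b *s v + c *s w" "\<And>g. \<exists>b c. T g w = b *s v + c *s w"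
  shows False
proof -
  define U W where "U = {z. \<exists>c. z = c *s u}" and "W = {z. \<exists>b c. z = b *s v + c *s w}"
  have "U = {0} \<or> W = {0}"
  proof (rule indec)
    show "vec.subspace U"
      unfolding vec.subspace_def U_def
    proof (intro conjI ballI allI)
      show "0 \<in> {z. \<exists>c. z = c *s u}" by (auto intro: exI[of _ 0])
    qed (auto simp: vec.scale_left_distrib[symmetric])
    have 1: "(a *s v + b *s w) + (c *s v + d *s w) = (a + c) *s v + (b + d) *s w" for a b c d
      by (simp add: vec.scale_left_distrib ac_simps)
    have 2: "d *s (a *s v + b *s w) = (d * a) *s v + (d * b) *s w" for a b d
      by (simp add: vec.scale_right_distrib)
    show "vec.subspace W"
      unfolding vec.subspace_def W_def
    proof (intro conjI ballI allI)
      show "0 \<in> {z. \<exists>b c. z = b *s v + c *s w}" by (auto intro!: exI[of _ 0])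
    qed (auto simp: 1 2; blast)+
    show "T g z \<in> U" if "z \<in> U" for g z
      using that assms(2)[of g] by (auto simp: U_def scale)
    show "T g z \<in> W" if z: "z \<in> W" for g z
    proof -
      obtain b c where "z = b *s v + c *s w" using z unfolding W_def by blast
      moreover obtain b1 c1 where "T g v = b1 *s v + c1 *s w" using assms(3) by blast
      moreover obtain b2 c2 where "T g w = b2 *s v + c2 *s w" using assms(4) by blast
      ultimately have "T g z = (b * b1 + c * b2) *s v + (b * c1 + c * c2) *s w"
        by (simp add: add scale) (simp add: vec_eq_iff algebra_simps)
      then show ?thesis unfolding W_def by blast
    qed
    have "z = 0" if "z \<in> U" "z \<in> W" for z
    proof -
      obtain a b c where z: "z = a *s u" "z = b *s v + c *s w" using \<open>z \<in> U\<close> \<open>z \<in> W\<close> unfolding U_def W_def by blast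
      have "a *s u + 0 *s v + 0 *s w = 0 *s u + b *s v + c *s w" using z by simp
      from basis3_eq[OF b this] z show "z = 0" by simp
    qed
    moreover have "0 \<in> U" "0 \<in> W"
      unfolding U_def W_def by (auto intro!: exI[of _ 0])
    ultimately show "U \<inter> W = {0}" by auto
    fix z
    show "\<exists>u\<in>U. \<exists>w\<in>W. z = u + w"
      using basis3_ex[OF b, of z] unfolding U_def W_def by (auto simp: add.assoc)
  qed
  moreover have "u \<in> U" "v \<in> W"
    unfolding U_def W_def by (auto intro: exI[of _ 1] exI[of _ 0])
  ultimately show False
    using basis3_nonzero[OF b] basis3_nonzero[OF basis3_swap12[OF b]] by auto
qed

text \<open>Averaging \<open>Z\<close> against \<open>\<mu>\<^sup>-\<^sup>1\<close> splits off the \<open>\<mu>\<close>-eigenspace as a direct summand.\<close>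

lemma central_finite_order_scalar:
  assumes lin: "\<And>u v. Z (u + v) = Z u + Z v" "\<And>c v. Z (c *s v) = c *s Z v"
    and n: "n > 0" "\<And>v. (Z ^^ n) v = v"
    and comm: "\<And>g v. Z (T g v) = T g (Z v)"
  obtains \<mu> where "\<mu> ^ n = 1" "\<And>v. Z v = \<mu> *s v"
proof -
  obtain \<mu> u where u: "u \<noteq> 0" "Z u = \<mu> *s u"
    using finite_order_eigenvector[OF lin n] by blast
  have pow: "(Z ^^ j) z = \<mu> ^ j *s z" if "Z z = \<mu> *s z" for j z
    by (induction j) (auto simp: lin that mult.commute)
  have "\<mu> ^ n *s u = 1 *s u" using pow[OF u(2), of n] n(2) by simp
  then have \<mu>n: "\<mu> ^ n = 1" using u(1) vec.scale_right_imp_eq by blast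
  then have \<mu>0: "\<mu> \<noteq> 0" using n(1) by (auto simp: power_0_left)
  have powlin: "(Z ^^ j) (a + b) = (Z ^^ j) a + (Z ^^ j) b" "(Z ^^ j) (c *s a) = c *s (Z ^^ j) a" for j a b c
    by (induction j) (auto simp: lin)
  have powcomm: "(Z ^^ j) (T g a) = T g ((Z ^^ j) a)" for j g a
    by (induction j) (auto simp: comm)
  \<comment> \<open>Up to the factor \<open>n\<close> this is the projection onto the eigenspace of
    \<mu>.\<close>
  define P where "P v = (\<Sum>j<n. (inverse \<mu> ^ j) *s (Z ^^ j) v)" for v
  have Z_sum: "Z (\<Sum>j\<in>A. f j) = (\<Sum>j\<in>A. Z (f j))" for A :: "nat set" and f
    using Z_zero[OF lin] by (induction A rule: infinite_finite_induct) (auto simp: lin)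
  have T_sum: "T g (\<Sum>j\<in>A. f j) = (\<Sum>j\<in>A. T g (f j))" for A :: "nat set" and f g
    by (induction A rule: infinite_finite_induct) (auto simp: add)
  have ZP: "Z (P v) = \<mu> *s P v" for v
  proof -
    let ?f = "\<lambda>j. (inverse \<mu> ^ j) *s (Z ^^ j) v"
    \<comment> \<open>Applying \<open>Z\<close> shifts the summation index by one. The term of index
      \<open>n\<close> that enters equals the term of index 0 that leaves, because both \<mu> and
      \<open>Z\<close> have \<open>n\<close>-th power 1.\<close>
    have "sum ?f {..<n} + ?f n = ?f 0 + (\<Sum>j<n. ?f (Suc j))"
      using sum.lessThan_Suc_shift[of ?f n] by simp
    moreover have "?f n = ?f 0" using \<mu>n n(2) by (simp add: power_inverse)
    ultimately have Pv: "(\<Sum>j<n. ?f (Suc j)) = P v" by (simp add: P_def)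
    have "Z (P v) = (\<Sum>j<n. \<mu> *s ?f (Suc j))"
      unfolding P_def Z_sum using \<mu>0 by (intro sum.cong) (auto simp: lin)
    also have "\<dots> = \<mu> *s (\<Sum>j<n. ?f (Suc j))"
      by (rule vec.scale_sum_right[symmetric])
    finally show ?thesis unfolding Pv .
  qed
  have P_eig: "P z = of_nat n *s z" if "Z z = \<mu> *s z" for z
  proof -
    have "P z = (\<Sum>j<n. 1 *s z)"
      using \<mu>0 by (simp add: P_def pow[OF that] power_inverse del: sum_constant)
    also have "\<dots> = (\<Sum>j<n. 1) *s z" by (rule vec.scale_sum_left[symmetric])
    finally show ?thesis by simp
  qed
  have P_add: "P (a + b) = P a + P b" and P_scale: "P (c *s a) = c *s P a" for a b c
    by (simp_all add: P_def powlin vec.scale_right_distrib sum.distrib vec.scale_sum_right mult.commute)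
  have P_diff: "P (a - b) = P a - P b" for a b
    using P_add[of "a - b" b] by simp
  have P_T: "P (T g a) = T g (P a)" for g a
    by (simp add: P_def powcomm T_sum scale)
  \<comment> \<open>Characteristic zero permits the division by \<open>n\<close> that turns
    \<open>P\<close> into a projection.\<close>
  have n0: "of_nat n \<noteq> (0 :: 'k)" using n(1) by simp
  define U W where "U = {z. Z z = \<mu> *s z}" and "W = {z. P z = 0}"
  have P0: "P 0 = 0" using P_scale[of 0 0] by simp
  have "U = {0} \<or> W = {0}"
  proof (rule indec)
    show "vec.subspace U" "vec.subspace W"
      by (auto simp: vec.subspace_def U_def W_def lin Z_zero[OF lin] vec.scale_right_distrib P_add P_scale P0 mult.commute)
    show "T g z \<in> U" if "z \<in> U" for g z using that by (simp add: U_def comm scale)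
    show "T g z \<in> W" if "z \<in> W" for g z using that by (simp add: W_def P_T)
    show "U \<inter> W = {0}"
      using P_eig n0 P0 Z_zero[OF lin] by (auto simp: U_def W_def)
    fix z
    have "P z \<in> U" by (simp add: U_def ZP)
    then have "inverse (of_nat n) *s P z \<in> U" using \<open>vec.subspace U\<close> vec.subspace_scale by blast
    moreover have "z - inverse (of_nat n) *s P z \<in> W"
      using n0 P_eig[OF ZP] by (simp add: W_def P_diff P_scale)
    moreover have "z = inverse (of_nat n) *s P z + (z - inverse (of_nat n) *s P z)"
      by simp
    ultimately show "\<exists>u\<in>U. \<exists>w\<in>W. z = u + w" by blast
  qed
  moreover have "u \<in> U" using u by (simp add: U_def)
  ultimately have "W = {0}" using u(1) by auto
  have "Z v = \<mu> *s v" for v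
  proof -
    have "v - inverse (of_nat n) *s P v \<in> W"
      using n0 P_eig[OF ZP] by (simp add: W_def P_diff P_scale)
    then have v: "v = inverse (of_nat n) *s P v" using \<open>W = {0}\<close> by auto
    show ?thesis by (subst (1 2) v) (simp add: lin ZP mult.commute)
  qed
  then show ?thesis using that \<mu>n by blast
qed

end

section \<open>Classification of three-dimensional representations\<close>

text \<open>The conditions contain only even powers of the two coordinates, so signs may be changed
  independently.\<close>

lemma O1_setI:
  assumes "(x, y) \<in> O1_set N M l1 l2 l3" "s \<in> {x, - x}" "t \<in> {y, - y}"
  shows "(s, t) \<in> O1_set N M l1 l2 l3"
  using assms by (auto simp: O1_set_def O_set_def)

text \<open>Witnesses for the invariance premises of \<open>no_invariant_line\<close>, in the shapes
  that the generators produce.\<close>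

lemma pair_span:
  fixes v w :: "'k::field ^ 'n"
  shows "\<exists>b c. a *s v = b *s v + c *s w" "\<exists>b c. a *s w = b *s v + c *s w"
    "\<exists>b c. - (a *s v) = b *s v + c *s w" "\<exists>b c. - (a *s w) = b *s v + c *s w"
    "\<exists>b c. b *s v + c *s w = 0"
proof -
  show "\<exists>b c. a *s v = b *s v + c *s w" by (rule exI[of _ a], rule exI[of _ 0]) simp
  show "\<exists>b c. a *s w = b *s v + c *s w" by (rule exI[of _ 0], rule exI[of _ a]) simp
  show "\<exists>b c. - (a *s v) = b *s v + c *s w" by (rule exI[of _ "- a"], rule exI[of _ 0]) simp
  show "\<exists>b c. - (a *s w) = b *s v + c *s w" by (rule exI[of _ 0], rule exI[of _ "- a"]) simp
  show "\<exists>b c. b *s v + c *s w = 0" by (rule exI[of _ 0], rule exI[of _ 0]) simp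
qed

text \<open>Since 2 is invertible, nonzero weights that differ by a sign are distinct; all parity
  arguments below depend on this.\<close>

lemma eq_neg_self: "(a::'a::field_char_0) = - a \<Longrightarrow> a = 0"
  by (metis add.right_inverse mult_2 mult_eq_0_iff zero_neq_numeral)

context rep3
begin



text \<open>An isomorphism with some \<open>M3 i \<chi>\<close> spelled out in coordinates: the
  \<open>e j\<close> form a basis on which the generators have the structure constants
  \<open>gen_basis\<close>.\<close>

definition classified :: bool where
  "classified \<longleftrightarrow> (\<exists>\<chi>\<in>O1_set N M l1 l2 l3. \<exists>i\<in>{1, 2, 3, 4}. \<exists>e.
    bij_betw (\<lambda>v. \<Sum>j\<in>basis_set i. v j *s e j) (carrier (M3 i \<chi>)) UNIV \<and>
    (\<forall>g. \<forall>j\<in>basis_set i. T g (e j) = (\<Sum>k\<in>basis_set i. gen_basis \<chi> i g j k *s e k)))"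

definition wt :: "'k \<Rightarrow> 'k \<Rightarrow> 'k ^ 3 \<Rightarrow> bool" where
  "wt s t v \<longleftrightarrow> T G1 v = s *s v \<and> T G2 v = t *s v"

lemma classifiedI:
  assumes "\<chi> \<in> O1_set N M l1 l2 l3" "i \<in> {1, 2, 3, 4}"
    and "basis_set i = {a, b, c}" "distinct [a, b, c]" "basis3 (e a) (e b) (e c)"
    and "\<And>g j. j \<in> {a, b, c} \<Longrightarrow>
      T g (e j) = gen_basis \<chi> i g j a *s e a + gen_basis \<chi> i g j b *s e b + gen_basis \<chi> i g j c *s e c"
  shows classified
  unfolding classified_def
proof (intro bexI exI conjI allI ballI)
  show "bij_betw (\<lambda>v. \<Sum>j\<in>basis_set i. v j *s e j) (carrier (M3 i \<chi>)) UNIV"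
    using basis3_coordinates[of e a b c] assms(3-5) by (simp add: M3_def)
  show "T g (e j) = (\<Sum>k\<in>basis_set i. gen_basis \<chi> i g j k *s e k)" if "j \<in> basis_set i" for g j
    using assms(3,4,6) that by (simp add: ac_simps)
qed (rule assms)+

lemma classified_1:
  assumes "(s, t) \<in> O1_set N M l1 l2 l3" "basis3 e1 e2 e3" "wt s t e1" "wt (- s) t e2" "wt s (- t) e3"
    "T A1 e1 = 0" "T A1 e2 = e1" "T A1 e3 = 0" "T A2 e1 = 0" "T A2 e2 = 0" "T A2 e3 = e2"
  shows classified
proof (rule classifiedI[OF assms(1), of 1 1 2 3 "\<lambda>j. if j = 1 then e1 else if j = 2 then e2 else e3"])
  fix g j assume "j \<in> {1, 2, 3::nat}"
  then show "T g (if j = 1 then e1 else if j = 2 then e2 else e3) =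
      gen_basis (s, t) 1 g j 1 *s (if 1 = (1::nat) then e1 else if 1 = (2::nat) then e2 else e3) +
      gen_basis (s, t) 1 g j 2 *s (if 2 = (1::nat) then e1 else if 2 = (2::nat) then e2 else e3) +
      gen_basis (s, t) 1 g j 3 *s (if 3 = (1::nat) then e1 else if 3 = (2::nat) then e2 else e3)"
    using assms by (cases g) (auto simp: wt_def basis_type_def basis_vec_def wt_bar_def wt_neg_def)
qed (use assms in \<open>auto simp: basis_set_def\<close>)

lemma classified_2:
  assumes "(s, t) \<in> O1_set N M l1 l2 l3" "basis3 e1 e2 e3" "wt s t e1" "wt (- s) t e2" "wt s (- t) e3"
    "T A1 e1 = 0" "T A1 e2 = e1" "T A1 e3 = 0" "T A2 e1 = 0" "T A2 e2 = e3" "T A2 e3 = 0"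
  shows classified
proof (rule classifiedI[OF assms(1), of 2 1 2 3 "\<lambda>j. if j = 1 then e1 else if j = 2 then e2 else e3"])
  fix g j assume "j \<in> {1, 2, 3::nat}"
  then show "T g (if j = 1 then e1 else if j = 2 then e2 else e3) =
      gen_basis (s, t) 2 g j 1 *s (if 1 = (1::nat) then e1 else if 1 = (2::nat) then e2 else e3) +
      gen_basis (s, t) 2 g j 2 *s (if 2 = (1::nat) then e1 else if 2 = (2::nat) then e2 else e3) +
      gen_basis (s, t) 2 g j 3 *s (if 3 = (1::nat) then e1 else if 3 = (2::nat) then e2 else e3)"
    using assms by (cases g) (auto simp: wt_def basis_type_def basis_vec_def wt_bar_def wt_neg_def)
qed (use assms in \<open>auto simp: basis_set_def\<close>)

lemma classified_3:
  assumes "(s, t) \<in> O1_set N M l1 l2 l3" "basis3 e1 e2 e4" "wt s t e1" "wt (- s) t e2" "wt (- s) (- t) e4"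
    "T A1 e1 = 0" "T A1 e2 = e1" "T A1 e4 = 0" "T A2 e1 = 0" "T A2 e2 = 0" "T A2 e4 = e1"
  shows classified
proof (rule classifiedI[OF assms(1), of 3 1 2 4 "\<lambda>j. if j = 1 then e1 else if j = 2 then e2 else e4"])
  fix g j assume "j \<in> {1, 2, 4::nat}"
  then show "T g (if j = 1 then e1 else if j = 2 then e2 else e4) =
      gen_basis (s, t) 3 g j 1 *s (if 1 = (1::nat) then e1 else if 1 = (2::nat) then e2 else e4) +
      gen_basis (s, t) 3 g j 2 *s (if 2 = (1::nat) then e1 else if 2 = (2::nat) then e2 else e4) +
      gen_basis (s, t) 3 g j 4 *s (if 4 = (1::nat) then e1 else if 4 = (2::nat) then e2 else e4)"
    using assms by (cases g) (auto simp: wt_def basis_type_def basis_vec_def wt_bar_def wt_neg_def)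
qed (use assms in \<open>auto simp: basis_set_def\<close>)

lemma classified_4:
  assumes "(s, t) \<in> O1_set N M l1 l2 l3" "basis3 e1 e3 e4" "wt s t e1" "wt s (- t) e3" "wt (- s) (- t) e4"
    "T A1 e1 = 0" "T A1 e3 = e4" "T A1 e4 = 0" "T A2 e1 = 0" "T A2 e3 = 0" "T A2 e4 = e1"
  shows classified
proof (rule classifiedI[OF assms(1), of 4 1 3 4 "\<lambda>j. if j = 1 then e1 else if j = 3 then e3 else e4"])
  fix g j assume "j \<in> {1, 3, 4::nat}"
  then show "T g (if j = 1 then e1 else if j = 3 then e3 else e4) =
      gen_basis (s, t) 4 g j 1 *s (if 1 = (1::nat) then e1 else if 1 = (3::nat) then e3 else e4) +
      gen_basis (s, t) 4 g j 3 *s (if 3 = (1::nat) then e1 else if 3 = (3::nat) then e3 else e4) +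
      gen_basis (s, t) 4 g j 4 *s (if 4 = (1::nat) then e1 else if 4 = (3::nat) then e3 else e4)"
    using assms by (cases g) (auto simp: wt_def basis_type_def basis_vec_def wt_bar_def wt_neg_def)
qed (use assms in \<open>auto simp: basis_set_def\<close>)

text \<open>One square-zero operator between a plane and a line cannot hold three dimensions
  together: it goes only out of the plane or only into it. Every vector of the plane has the same
  type, so a kernel vector, or a complement of the image, spans a line that splits off.\<close>

lemma decomposable_of_one_arrow:
  assumes b: "basis3 u v w"
    and wts: "wt s t u" "wt s t v" "wt s' t' w"
    and gh: "\<And>g. g \<in> {G1, G2, a, b}"
    and kill: "T b u = 0" "T b v = 0" "T b w = 0"
    and A: "T a u = c *s w" "T a v = d *s w" "T a w = p *s u + q *s v"
    and sq: "\<And>z. T a (T a z) = 0"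
  shows False
proof -
  have split: False
    if b: "basis3 u v w" and "wt s t u" "wt s t v" "wt s' t' w" "T b u = 0" "T b v = 0" "T b w = 0"
      and "T a u = 0" "\<exists>d. T a v = d *s w" "\<exists>q. T a w = q *s v" for u v w
  proof (rule no_invariant_line[OF b])
    fix g
    show "\<exists>c. T g u = c *s u"
      using gh[of g] that by (auto simp: wt_def intro: exI[of _ 0])
    show "\<exists>b c. T g v = b *s v + c *s w"
      using gh[of g] that
      by (auto simp: wt_def pair_span)
    show "\<exists>b c. T g w = b *s v + c *s w"
      using gh[of g] that
      by (auto simp: wt_def pair_span)
  qed
  have w0: "w \<noteq> 0" using basis3_nonzero[OF basis3_swap12[OF basis3_swap23[OF b]]] .
  have wt_lin: "wt s t (m *s u + n *s v)" for m n
    using wts by (simp add: wt_def add scale vec.scale_right_distrib mult.commute)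
  have "c *s (p *s u + q *s v) = 0" "d *s (p *s u + q *s v) = 0"
    using sq[of u] sq[of v] by (simp_all add: A scale)
  then have "(c * p) *s u + (c * q) *s v + 0 *s w = 0" "(d * p) *s u + (d * q) *s v + 0 *s w = 0"
    by (simp_all add: vec.scale_right_distrib)
  then have z: "c * p = 0" "c * q = 0" "d * p = 0" "d * q = 0"
    using basis3_zero[OF b] by blast+
  show False
  proof (cases "p = 0 \<and> q = 0")
    case pq: True
    show False
    proof (cases "c = 0")
      case True
      then show False using split[OF b] wts kill A pq by (auto intro: exI[of _ 0])
    next
      case False
      \<comment> \<open>The combination v - (d/c) u is killed by \<open>T a\<close>. It splits off
        from \<open>u\<close> and \<open>w\<close>, which are joined by the remaining arrow.\<close>
      have "basis3 (1 *s v + (- d / c) *s u + 0 *s w) u w"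
        by (rule basis3_replace[OF basis3_swap12[OF b]]) simp
      then have "basis3 (v - (d / c) *s u) u w" by simp
      moreover have "wt s t (v - (d / c) *s u)"
        using wt_lin[of "- (d / c)" 1] by simp
      ultimately show False
        by (rule split) (use wts kill A pq False in \<open>auto simp: diff scale intro: exI[of _ 0]\<close>)
    qed
  next
    case pq: False
    then have cd: "c = 0" "d = 0" using z by auto
    \<comment> \<open>The image \<open>T a w\<close> becomes the second basis vector, and one of
      \<open>u\<close>, \<open>v\<close> that is independent of it splits off: \<open>v\<close> if p
      is nonzero, \<open>u\<close> otherwise.\<close>
    show False
    proof (cases "p = 0")
      case False
      have "basis3 v (p *s u + q *s v) w"
        using basis3_swap12[OF basis3_replace[OF b False, of q 0]] by simp
      then show False
        by (rule split) (use wts wt_lin kill A cd in \<open>auto simp: add scale intro: exI[of _ 1] exI[of _ 0]\<close>)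
    next
      case True
      then have "basis3 u (q *s v) w"
        using basis3_swap12[OF basis3_replace[OF basis3_swap12[OF b], of q 0 0]] pq by simp
      then show False
        by (rule split) (use wts wt_lin[of 0 q] kill A cd True in \<open>auto simp: add scale intro: exI[of _ 1] exI[of _ 0]\<close>)
    qed
  qed
qed

end

section \<open>Representations on which the squares of the group generators are scalars\<close>

locale rep3_square = rep3 T N M l1 l2 l3
  for T :: "gen \<Rightarrow> 'k::{alg_closed_field, field_char_0} ^ 3 \<Rightarrow> 'k ^ 3" and N M l1 l2 l3 +
  fixes x y :: 'k
  assumes g1_sq: "T G1 (T G1 v) = x\<^sup>2 *s v" and g2_sq: "T G2 (T G2 v) = y\<^sup>2 *s v"
    and xy_O: "(x, y) \<in> O_set N M"
begin

lemma x0 [simp]: "x \<noteq> 0" and y0 [simp]: "y \<noteq> 0"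
  using xy_O N_pos M_pos by (auto simp: O_set_def power_0_left)

lemma weight_vectors_span: "vec.span {z. \<exists>s\<in>{x, - x}. \<exists>t\<in>{y, - y}. wt s t z} = UNIV" (is "vec.span ?S = _")
proof -
  \<comment> \<open>The product of the projections (1 + g1/s)/2 and (1 + g2/t)/2 onto eigenspaces.
    Over the four choices of signs these products add up to the identity.\<close>
  define q where "q s t v = (1 / 4) *s (v + (1 / s) *s T G1 v + (1 / t) *s T G2 v + (1 / (s * t)) *s T G1 (T G2 v))"
    for s t v
  have "wt s t (q s t v)" if "s \<in> {x, - x}" "t \<in> {y, - y}" for s t v
  proof -
    have st: "s\<^sup>2 = x\<^sup>2" "t\<^sup>2 = y\<^sup>2" "s \<noteq> 0" "t \<noteq> 0" using that by auto
    have "T G2 (T G1 (T G2 v)) = y\<^sup>2 *s T G1 v" "T G1 (T G1 (T G2 v)) = x\<^sup>2 *s T G2 v"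
      using g1_g2[of "T G2 v"] by (simp_all add: g1_sq g2_sq scale)
    moreover have "T G2 (T G1 v) = T G1 (T G2 v)" by (simp add: g1_g2)
    ultimately show ?thesis
      using st(3,4) unfolding wt_def q_def
      by (simp add: add scale g1_sq g2_sq st(1,2)[symmetric])
        (simp add: vec_eq_iff field_simps power2_eq_square)
  qed
  then have "q s t v \<in> vec.span ?S" if "s \<in> {x, - x}" "t \<in> {y, - y}" for s t v
    using that by (intro vec.span_base) blast
  then have A: "q x y v + q x (- y) v + (q (- x) y v + q (- x) (- y) v) \<in> vec.span ?S" for v
    by (intro vec.span_add) auto
  have B: "q x y v + q x (- y) v + (q (- x) y v + q (- x) (- y) v) = v" for v
    unfolding q_def by (simp add: vec_eq_iff field_simps)
  have "v \<in> vec.span ?S" for v using A[of v] unfolding B .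
  then show ?thesis by blast
qed

text \<open>Comparing coefficients removes every basis vector with eigenvalue \<open>x\<close>, as x
  and -x differ. The case \<open>r = x\<close> is that of a basis without odd part, where
  \<open>z\<close> must vanish.\<close>

lemma odd_line:
  assumes b: "basis3 u v w" and "T G1 u = x *s u" "T G1 v = x *s v" "T G1 w = r *s w" "r \<in> {x, - x}"
    and z: "T G1 z = (- x) *s z"
  shows "\<exists>c. z = c *s w \<and> (r = x \<longrightarrow> c = 0)"
proof -
  obtain a b' c where zz: "z = a *s u + b' *s v + c *s w" using basis3_ex[OF b] by blast
  have "(a * x) *s u + (b' * x) *s v + (c * r) *s w = (- x * a) *s u + (- x * b') *s v + (- x * c) *s w"
    using z unfolding zz using assms(2-4) by (simp add: add scale vec_eq_iff algebra_simps)
  from basis3_eq[OF b this] have "a * x = - (a * x)" "b' * x = - (b' * x)" "r = x \<Longrightarrow> c * x = - (c * x)"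
    by (simp_all add: mult.commute)
  then have "a = 0" "b' = 0" "r = x \<Longrightarrow> c = 0"
    by (auto dest!: eq_neg_self)
  then show ?thesis using zz by auto
qed

text \<open>The plane of \<open>u\<close> and \<open>v\<close> is sent into the line of
  \<open>w\<close>. If X u = c w and X v = d w, then d u - c v is killed, and it is nonzero unless c
  = 0, when \<open>u\<close> itself is killed.\<close>

lemma odd_kernel:
  assumes b: "basis3 u v w" and wts: "T G1 u = x *s u" "T G1 v = x *s v" "T G1 w = r *s w" "r \<in> {x, - x}"
    and X: "\<And>a b. X (a + b) = X a + X b" "\<And>c a. X (c *s a) = c *s X a" "\<And>a. T G1 (X a) = - X (T G1 a)"
  shows "\<exists>n. n \<noteq> 0 \<and> X n = 0"
proof -
  have "T G1 (X u) = (- x) *s X u" "T G1 (X v) = (- x) *s X v"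
    by (simp_all add: X wts)
  then obtain c d where cd: "X u = c *s w" "X v = d *s w"
    using odd_line[OF b wts] by metis
  show ?thesis
  proof (cases "c = 0")
    case True
    then show ?thesis using cd basis3_nonzero[OF b] by auto
  next
    case False
    have "d *s u + (- c) *s v \<noteq> 0"
      using basis3_zero[OF b, of d "- c" 0] False by auto
    moreover have "X (d *s u + (- c) *s v) = 0"
      by (simp only: X cd) (simp add: vec_eq_iff)
    ultimately show ?thesis by blast
  qed
qed

lemma in_O1:
  assumes b: "basis3 u v w" and wts: "T G1 u = x *s u" "T G1 v = x *s v" "T G1 w = r *s w" "r \<in> {x, - x}"
  shows "(x, y) \<in> O1_set N M l1 l2 l3"
proof -
  \<comment> \<open>The scalars by which the left sides of the three quadratic and quartic relations
    act; membership in \<open>O1_set\<close> says that they vanish.\<close>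
  define \<alpha> \<beta> \<gamma> where "\<alpha> = l1 * (1 - x\<^sup>2)" and "\<beta> = l2 * (1 - y\<^sup>2)"
    and "\<gamma> = l3 * (1 - x\<^sup>2 * y\<^sup>2) - 2 * l1 * l2 * (1 + y\<^sup>2) * (1 - x\<^sup>2)"
  have a1: "T A1 (T A1 z) = \<alpha> *s z" for z
    by (simp add: a1_a1 g1_sq \<alpha>_def vec_eq_iff algebra_simps)
  have a2: "T A2 (T A2 z) = \<beta> *s z" for z
    by (simp add: a2_a2 g2_sq \<beta>_def vec_eq_iff algebra_simps)
  have a12: "T A1 (T A2 (T A1 (T A2 z))) + T A2 (T A1 (T A2 (T A1 z))) = \<gamma> *s z" for z
    unfolding a1_a2 by (simp add: g1_sq g2_sq scale diff \<gamma>_def vec_eq_iff algebra_simps)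
  note ker = odd_kernel[OF b wts]
  obtain n1 where "n1 \<noteq> 0" "T A1 n1 = 0"
    using ker[of "T A1"] by (auto simp: add scale g1_a1)
  then have \<alpha>: "\<alpha> = 0" using a1[of n1] by simp
  obtain n2 where "n2 \<noteq> 0" "T A2 n2 = 0"
    using ker[of "T A2"] by (auto simp: add scale g1_a2)
  then have \<beta>: "\<beta> = 0" using a2[of n2] by simp
  define X where "X z = T A1 z + T A2 z" for z
  obtain n where n: "n \<noteq> 0" "X n = 0"
    using ker[of X] by (auto simp: X_def add scale g1_a1 g1_a2 vec.scale_right_distrib)
  \<comment> \<open>With both squares zero only the mixed products survive. The same cancellation on
    squaring again leaves the two alternating words of length four.\<close>
  have XX: "X (X z) = T A1 (T A2 z) + T A2 (T A1 z)" for z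
    by (simp add: X_def add a1 a2 \<alpha> \<beta>)
  have "X (X (X (X n))) = \<gamma> *s n"
    unfolding XX[of n] XX unfolding a12[symmetric] by (simp add: add a1 a2 \<alpha> \<beta>)
  moreover have "X (X (X (X n))) = 0" by (simp add: n(2)) (simp add: X_def)
  ultimately have "\<gamma> = 0" using n(1) by simp
  then show ?thesis using \<alpha> \<beta> xy_O by (simp add: O1_set_def \<alpha>_def \<beta>_def \<gamma>_def)
qed

text \<open>The odd part is the line of \<open>w\<close>, whose second weight is \<open>y\<close>; a
  vector in it of second weight -y vanishes.\<close>

lemma odd_weight:
  assumes b: "basis3 u v w" and "wt x s u" "wt x t v" "wt (- x) y w" and z: "wt (- x) r z" "r \<in> {y, - y}"
  shows "\<exists>c. z = c *s w \<and> (r = - y \<longrightarrow> c = 0)"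
proof -
  obtain c where c: "z = c *s w"
    using odd_line[OF b, of "- x" z] assms by (auto simp: wt_def)
  have w0: "w \<noteq> 0" using basis3_nonzero[OF basis3_swap12[OF basis3_swap23[OF b]]] .
  have "(c * y) *s w = (r * c) *s w"
    using z assms(4) by (simp add: wt_def c scale)
  then have "c * y = r * c" using w0 vec.scale_right_imp_eq by blast
  then show ?thesis using c eq_neg_self[of "c * y"] by (auto simp: mult.commute)
qed

text \<open>The eigenvalue of g1 removes the \<open>w\<close> coordinate, and that of g2 removes
  \<open>u\<close> or \<open>v\<close> when its second weight is not \<open>r\<close>.\<close>

lemma even_weight:
  assumes b: "basis3 u v w" and "wt x s u" "wt x t v" "wt (- x) y w" "wt x r z"
  shows "\<exists>p q. z = p *s u + q *s v \<and> (s \<noteq> r \<longrightarrow> p = 0) \<and> (t \<noteq> r \<longrightarrow> q = 0)"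
proof -
  obtain p q c where z: "z = p *s u + q *s v + c *s w" using basis3_ex[OF b] by blast
  have "(p * x) *s u + (q * x) *s v + (- (c * x)) *s w = (p * x) *s u + (q * x) *s v + (c * x) *s w"
    using assms(2-5) unfolding wt_def z by (simp add: add scale vec_eq_iff algebra_simps)
  from basis3_eq[OF b this] have "c = 0" using eq_neg_self[of "c * x"] by auto
  then have z: "z = p *s u + q *s v" using z by simp
  have "(p * s) *s u + (q * t) *s v + 0 *s w = (p * r) *s u + (q * r) *s v + 0 *s w"
    using assms(2-5) unfolding wt_def z by (simp add: add scale vec_eq_iff algebra_simps)
  from basis3_eq[OF b this] show ?thesis using z by auto
qed

lemma a1_wt: "wt s t z \<Longrightarrow> wt (- s) t (T A1 z)"
  by (simp add: wt_def g1_a1 g2_a1 scale)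

lemma a2_wt: "wt s t z \<Longrightarrow> wt (- s) (- t) (T A2 z)"
  by (simp add: wt_def g1_a2 g2_a2 scale)

lemma a_sq_zero:
  assumes "(x, y) \<in> O1_set N M l1 l2 l3"
  shows "T A1 (T A1 z) = 0" "T A2 (T A2 z) = 0"
proof -
  have "T A1 (T A1 z) = (l1 * (1 - x\<^sup>2)) *s z" "T A2 (T A2 z) = (l2 * (1 - y\<^sup>2)) *s z"
    unfolding a1_a1 a2_a2 g1_sq g2_sq by (simp_all add: vec_eq_iff algebra_simps)
  then show "T A1 (T A1 z) = 0" "T A2 (T A2 z) = 0"
    using assms by (simp_all add: O1_set_def)
qed

text \<open>Both generators change the first weight, but only \<open>A2\<close> changes the second.
  Hence \<open>A1\<close> alone can join the plane to \<open>w\<close> if \<open>t = y\<close>, and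
  \<open>A2\<close> alone if \<open>t = - y\<close>, which leaves the situation of
  \<open>decomposable_of_one_arrow\<close>.\<close>

lemma even_part_homogeneous:
  assumes b: "basis3 u v w" and wts: "wt x t u" "wt x t v" "wt (- x) y w" "t \<in> {y, - y}"
  shows False
proof -
  have O1: "(x, y) \<in> O1_set N M l1 l2 l3"
    using in_O1[OF b, of "- x"] wts by (simp add: wt_def)
  note sq = a_sq_zero[OF O1]
  note ow = odd_weight[OF b wts(1-3)] and ew = even_weight[OF b wts(1-3)]
  have ny: "- y \<noteq> y" using eq_neg_self[of y] by auto
  show False
  proof (cases "t = y")
    case True
    have "T A2 u = 0" "T A2 v = 0"
      using ow[OF a2_wt[OF wts(1)]] ow[OF a2_wt[OF wts(2)]] True by auto
    moreover have "T A2 w = 0"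
      using ew[of "- y" "T A2 w"] a2_wt[OF wts(3)] True ny by auto
    moreover obtain c d where "T A1 u = c *s w" "T A1 v = d *s w"
      using ow[OF a1_wt[OF wts(1)] wts(4)] ow[OF a1_wt[OF wts(2)] wts(4)] by blast
    moreover obtain p q where "T A1 w = p *s u + q *s v"
      using ew[of y "T A1 w"] a1_wt[OF wts(3)] by auto
    moreover have "g \<in> {G1, G2, A1, A2}" for g by (cases g) auto
    ultimately show False
      using decomposable_of_one_arrow[OF b wts(1-3), of A1 A2] sq by blast
  next
    case False
    then have t: "t = - y" using wts(4) by simp
    have "T A1 u = 0" "T A1 v = 0"
      using ow[OF a1_wt[OF wts(1)]] ow[OF a1_wt[OF wts(2)]] t by auto
    moreover have "T A1 w = 0"
      using ew[of y "T A1 w"] a1_wt[OF wts(3)] t ny by auto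
    moreover obtain c d where "T A2 u = c *s w" "T A2 v = d *s w"
      using ow[OF a2_wt[OF wts(1)]] ow[OF a2_wt[OF wts(2)]] t by auto
    moreover obtain p q where "T A2 w = p *s u + q *s v"
      using ew[of "- y" "T A2 w"] a2_wt[OF wts(3)] by auto
    moreover have "g \<in> {G1, G2, A2, A1}" for g by (cases g) auto
    ultimately show False
      using decomposable_of_one_arrow[OF b wts(1-3), of A2 A1] sq by blast
  qed
qed

text \<open>By types, \<open>A1\<close> acts only between \<open>u\<close> and \<open>w\<close>, and
  \<open>A2\<close> only between \<open>v\<close> and \<open>w\<close>. As the squares vanish, each
  acts in at most one direction (c p = 0 and d q = 0); if one acted in neither direction,
  \<open>u\<close> or \<open>v\<close> would split off. The four combinations of directions
  remain.\<close>

lemma even_part_mixed: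
  assumes b: "basis3 u v w" and wts: "wt x y u" "wt x (- y) v" "wt (- x) y w"
  shows classified
proof -
  have O1: "(x, y) \<in> O1_set N M l1 l2 l3"
    using in_O1[OF b, of "- x"] wts by (simp add: wt_def)
  note sq = a_sq_zero[OF O1]
  note ow = odd_weight[OF b wts] and ew = even_weight[OF b wts]
  have ny: "- y \<noteq> y" "y \<noteq> - y" using eq_neg_self[of y] by auto
  have bu: "u \<noteq> 0" and bv: "v \<noteq> 0"
    using basis3_nonzero[OF b] basis3_nonzero[OF basis3_swap12[OF b]] .
  obtain c where c: "T A1 u = c *s w" using ow[OF a1_wt[OF wts(1)]] by auto
  obtain d where d: "T A2 v = d *s w" using ow[OF a2_wt[OF wts(2)]] by auto
  have uv: "T A2 u = 0" "T A1 v = 0"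
    using ow[OF a2_wt[OF wts(1)]] ow[OF a1_wt[OF wts(2)]] by auto
  obtain p where p: "T A1 w = p *s u"
    using ew[of y "T A1 w"] a1_wt[OF wts(3)] ny by auto
  obtain q where q: "T A2 w = q *s v"
    using ew[of "- y" "T A2 w"] a2_wt[OF wts(3)] ny by auto
  have cp: "c * p = 0" using sq(1)[of u] bu by (simp add: c p scale)
  have dq: "d * q = 0" using sq(2)[of v] bv by (simp add: d q scale)
  have gens: "g \<in> {G1, G2, A1, A2}" for g by (cases g) auto
  have u_splits: False if "c = 0" "p = 0"
  proof (rule no_invariant_line[OF b])
    fix g
    show "\<exists>c. T g u = c *s u"
      using gens[of g] wts uv c that by (auto simp: wt_def intro: exI[of _ 0])
    show "\<exists>b c. T g v = b *s v + c *s w"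
      using gens[of g] wts uv d
      by (auto simp: wt_def pair_span)
    show "\<exists>b c. T g w = b *s v + c *s w"
      using gens[of g] wts p q that
      by (auto simp: wt_def pair_span)
  qed
  have v_splits: False if "d = 0" "q = 0"
  proof (rule no_invariant_line[OF basis3_swap12[OF b]])
    fix g
    show "\<exists>c. T g v = c *s v"
      using gens[of g] wts uv d that by (auto simp: wt_def intro: exI[of _ 0] exI[of _ "- y"])
    show "\<exists>b c. T g u = b *s u + c *s w"
      using gens[of g] wts uv c
      by (auto simp: wt_def pair_span)
    show "\<exists>b c. T g w = b *s u + c *s w"
      using gens[of g] wts p q that
      by (auto simp: wt_def pair_span)
  qed
  \<comment> \<open>Rescaling \<open>u\<close> and \<open>v\<close> while keeping \<open>w\<close>
    normalises both arrows to coefficient 1.\<close>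
  have scaled: "basis3 (m *s u) (k *s v) w" if "m \<noteq> 0" "k \<noteq> 0" for m k
    using basis3_swap12[OF basis3_replace[OF basis3_swap12[OF basis3_replace[OF b that(1), of 0 0]] that(2), of 0 0]]
    by simp
  have wt_scale: "wt s t (m *s z)" if "wt s t z" for s t m z
    using that by (simp add: wt_def scale mult.commute)
  have O1': "(s, t) \<in> O1_set N M l1 l2 l3" if "s \<in> {x, - x}" "t \<in> {y, - y}" for s t
    using O1_setI[OF O1 that] .
  show ?thesis
  proof (cases "p = 0")
    case p0: False
    then have c0: "c = 0" using cp by simp
    show ?thesis
    proof (cases "q = 0")
      case q0: False
      then have "d = 0" using dq by simp
      then show ?thesis
        by (intro classified_2[OF O1 basis3_swap23[OF scaled[OF p0 q0]]])
          (simp_all add: wts wt_scale c d uv p q c0 scale)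
    next
      case q0: True
      then have d0: "d \<noteq> 0" using v_splits by blast
      then show ?thesis
        by (intro classified_1[OF O1 basis3_swap23[OF scaled[OF p0, of "inverse d"]]])
          (simp_all add: wts wt_scale c d uv p q c0 q0 scale)
    qed
  next
    case p0: True
    then have c0: "c \<noteq> 0" using u_splits by blast
    show ?thesis
    proof (cases "q = 0")
      case q0: False
      then have "d = 0" using dq by simp
      \<comment> \<open>The path runs from \<open>u\<close> through \<open>w\<close> to
        \<open>v\<close>. Its end plays the role of e1, so the parameter is (x, -y), the type of
        \<open>v\<close>.\<close>
      have "basis3 (q *s v) (inverse c *s u) w"
        using basis3_swap12[OF scaled[of "inverse c" q]] c0 q0 by simp
      then show ?thesis
        using O1'[of x "- y"] \<open>d = 0\<close> c0
        by (intro classified_4[of x "- y" "q *s v" "inverse c *s u" w])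
          (simp_all add: wts wt_scale c d uv p q p0 scale)
    next
      case q0: True
      then have d0: "d \<noteq> 0" using v_splits by blast
      \<comment> \<open>Both arrows end in \<open>w\<close>, which therefore plays the role of e1,
        and the parameter is its type (-x, y).\<close>
      have "basis3 w (inverse c *s u) (inverse d *s v)"
        using basis3_swap12[OF basis3_swap23[OF scaled[of "inverse c" "inverse d"]]] c0 d0 by simp
      then show ?thesis
        using O1'[of "- x" y] c0 d0
        by (intro classified_3[of "- x" y w "inverse c *s u" "inverse d *s v"])
          (simp_all add: wts wt_scale c d uv p q p0 q0 scale)
    qed
  qed
qed

text \<open>There is no odd vector for \<open>A1\<close> and \<open>A2\<close> to reach, so they act
  by zero and every basis vector spans an invariant line.\<close>

lemma purely_even:
  assumes b: "basis3 u v w" and wts: "wt x r u" "wt x s v" "wt x t w"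
  shows False
proof -
  have zero: "T A1 z = 0 \<and> T A2 z = 0" if "wt x t z" for z t
    using odd_line[OF b, of x "T A1 z"] odd_line[OF b, of x "T A2 z"] a1_wt[OF that] a2_wt[OF that] wts
    by (auto simp: wt_def)
  have diag: "\<exists>c. T g z = c *s z" if "wt x t z" for g z t
    using that zero[OF that] by (cases g) (auto simp: wt_def intro: exI[of _ 0])
  show False
    by (rule no_invariant_line[OF b]) (use diag[OF wts(1)] diag[OF wts(2)] diag[OF wts(3)] pair_span in metis)+
qed

text \<open>The assumptions see only even powers of \<open>x\<close> and \<open>y\<close>. The
  locale can thus be entered again with the signs that suit the basis at hand.\<close>

lemma negate: "s \<in> {x, - x} \<Longrightarrow> t \<in> {y, - y} \<Longrightarrow> rep3_square T N M l1 l2 l3 s t"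
  using xy_O by unfold_locales (auto simp: g1_sq g2_sq O_set_def)

lemma two_even:
  assumes b: "basis3 u v w" and wts: "wt x r u" "wt x s v" "wt m t w"
    and "r \<in> {y, - y}" "s \<in> {y, - y}" "t \<in> {y, - y}" "m \<in> {x, - x}"
  shows classified
proof (cases "m = x")
  case True
  then show ?thesis using purely_even[OF b] wts by blast
next
  case False
  then have m: "m = - x" using assms by simp
  \<comment> \<open>The sign of the second root is chosen so that \<open>w\<close> has the type (-x,
    y) assumed by the normal forms.\<close>
  interpret Y: rep3_square T N M l1 l2 l3 x t
    by (rule negate) (use assms in auto)
  have "r \<in> {t, - t}" "s \<in> {t, - t}" using assms by auto
  then consider "r = s" | "r = t" "s = - t" | "r = - t" "s = t" by auto
  then show ?thesis
  proof cases
    case 1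
    then show ?thesis
      using Y.even_part_homogeneous[OF b, of r] wts m \<open>r \<in> {t, - t}\<close> by auto
  next
    case 2
    then show ?thesis using Y.even_part_mixed[OF b] wts m by simp
  next
    case 3
    then show ?thesis using Y.even_part_mixed[OF basis3_swap12[OF b]] wts m by simp
  qed
qed

lemma classified: classified
proof -
  let ?S = "{z. \<exists>s\<in>{x, - x}. \<exists>t\<in>{y, - y}. wt s t z}"
  obtain u v w where "u \<in> ?S" "v \<in> ?S" "w \<in> ?S" and b: "basis3 u v w"
    by (rule spanning_set_basis3[OF weight_vectors_span])
  then obtain s1 t1 s2 t2 s3 t3 where wts: "wt s1 t1 u" "wt s2 t2 v" "wt s3 t3 w"
    and s: "s1 \<in> {x, - x}" "s2 \<in> {x, - x}" "s3 \<in> {x, - x}"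
    and t: "t1 \<in> {y, - y}" "t2 \<in> {y, - y}" "t3 \<in> {y, - y}" by blast
  have y: "y \<in> {y, - y}" by simp
  \<comment> \<open>Three first weights take only two values, so two of them agree.\<close>
  consider "s1 = s2" | "s1 = s3" | "s2 = s3" using s by auto
  then show ?thesis
  proof cases
    case 1
    interpret S: rep3_square T N M l1 l2 l3 s1 y by (rule negate[OF s(1) y])
    show ?thesis
      by (rule S.two_even[OF b wts(1) _ wts(3), of t2]) (use wts s t 1 in auto)
  next
    case 2
    interpret S: rep3_square T N M l1 l2 l3 s1 y by (rule negate[OF s(1) y])
    show ?thesis
      by (rule S.two_even[OF basis3_swap23[OF b] wts(1) _ wts(2), of t3]) (use wts s t 2 in auto)
  next
    case 3
    interpret S: rep3_square T N M l1 l2 l3 s2 y by (rule negate[OF s(2) y])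
    show ?thesis
      by (rule S.two_even[OF basis3_swap23[OF basis3_swap12[OF b]] wts(2) _ wts(1), of t3]) (use wts s t 3 in auto)
  qed
qed

end

context rep3
begin

theorem classification: classified
proof -
  have pow2: "((\<lambda>v. T g (T g v)) ^^ n) v = (T g ^^ (2 * n)) v" for g n v
    by (induction n) auto
  obtain \<mu> where \<mu>: "\<mu> ^ N = 1" "\<And>v. T G1 (T G1 v) = \<mu> *s v"
  proof (rule central_finite_order_scalar[of "\<lambda>v. T G1 (T G1 v)" N])
    \<comment> \<open>Anticommuting twice is commuting, which makes the square central.\<close>
    show "T G1 (T G1 (T g v)) = T g (T G1 (T G1 v))" for g v
      by (cases g) (simp_all add: g1_g2 g1_a1 g1_a2)
  qed (simp_all add: add scale N_pos pow2 g1_pow)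
  obtain \<nu> where \<nu>: "\<nu> ^ M = 1" "\<And>v. T G2 (T G2 v) = \<nu> *s v"
  proof (rule central_finite_order_scalar[of "\<lambda>v. T G2 (T G2 v)" M])
    show "T G2 (T G2 (T g v)) = T g (T G2 (T G2 v))" for g v
      by (cases g) (simp_all add: g1_g2 g2_a1 g2_a2)
  qed (simp_all add: add scale M_pos pow2 g2_pow)
  \<comment> \<open>The roots exist over an algebraically closed field, and \<mu>^N = 1 makes
    \<open>x\<close> a root of unity of order dividing 2N; likewise for \<open>y\<close>.\<close>
  obtain x y where xy: "x\<^sup>2 = \<mu>" "y\<^sup>2 = \<nu>"
    using nth_root_exists[of 2 \<mu>] nth_root_exists[of 2 \<nu>] by auto
  interpret rep3_square T N M l1 l2 l3 x y
    by unfold_locales (use \<mu> \<nu> xy in \<open>auto simp: O_set_def power_mult\<close>)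
  show ?thesis by (rule classified)
qed

end

section \<open>The modules \<open>M\<^sub>3\<^sub>,\<^sub>i\<^sup>\<chi>\<close>\<close>

lemma free_act_superset:
  assumes "finite S" "Poly_Mapping.keys p \<subseteq> S"
  shows "free_act \<chi> i p v k = (\<Sum>w\<in>S. Poly_Mapping.lookup p w * foldr (gen_act \<chi> i) (letters w) v k)"
  unfolding free_act_def using assms
  by (intro sum.mono_neutral_left) (auto simp: in_keys_iff)

lemma free_act_single: "free_act \<chi> i (Poly_Mapping.single w c) v = (\<lambda>k. c * foldr (gen_act \<chi> i) (letters w) v k)"
  by (rule ext, subst free_act_superset[of "{w}"]) auto

lemma free_act_add: "free_act \<chi> i (p + q) v = (\<lambda>k. free_act \<chi> i p v k + free_act \<chi> i q v k)"
proof
  fix k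
  let ?S = "Poly_Mapping.keys p \<union> Poly_Mapping.keys q"
  show "free_act \<chi> i (p + q) v k = free_act \<chi> i p v k + free_act \<chi> i q v k"
    using Poly_Mapping.keys_add[of p q]
    by (simp add: free_act_superset[of ?S] lookup_add distrib_right sum.distrib)
qed

lemma gen_act_add: "gen_act \<chi> i x (\<lambda>k. u k + v k) = (\<lambda>k. gen_act \<chi> i x u k + gen_act \<chi> i x v k)"
  by (simp add: gen_act_def distrib_right sum.distrib)

lemma gen_act_scale: "gen_act \<chi> i x (\<lambda>k. c * v k) = (\<lambda>k. c * gen_act \<chi> i x v k)"
  by (simp add: gen_act_def sum_distrib_left mult.assoc)

lemma foldr_gen_act_add: "foldr (gen_act \<chi> i) xs (\<lambda>k. u k + v k) =
    (\<lambda>k. foldr (gen_act \<chi> i) xs u k + foldr (gen_act \<chi> i) xs v k)"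
  by (induction xs) (simp_all add: gen_act_add)

lemma foldr_gen_act_scale: "foldr (gen_act \<chi> i) xs (\<lambda>k. c * v k) = (\<lambda>k. c * foldr (gen_act \<chi> i) xs v k)"
  by (induction xs) (simp_all add: gen_act_scale)

lemma free_act_add_right: "free_act \<chi> i p (\<lambda>k. u k + v k) = (\<lambda>k. free_act \<chi> i p u k + free_act \<chi> i p v k)"
  by (simp add: free_act_def foldr_gen_act_add distrib_left sum.distrib)

lemma free_act_mult: "free_act \<chi> i (p * q) v = free_act \<chi> i p (free_act \<chi> i q v)"
proof (induction p rule: free_single_induct)
  case (single w c)
  show ?case
  proof (induction q rule: free_single_induct)
    case (single w' c')
    show ?case
      by (simp add: mult_single free_act_single foldr_gen_act_scale plus_word_def mult.assoc)
  qed (simp add: distrib_left free_act_add free_act_add_right)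
qed (simp add: distrib_right free_act_add)

lemma free_act_const: "free_act \<chi> i (const c) v = (\<lambda>k. c * v k)"
  by (simp add: const_def free_act_single zero_word_def)

lemma free_act_one: "free_act \<chi> i 1 v = v"
  using free_act_const[of \<chi> i 1 v] by (simp add: const_1)

lemma free_act_gen: "free_act \<chi> i (gen x) v = gen_act \<chi> i x v"
  by (simp add: gen_def free_act_single)

lemma free_act_zero: "free_act \<chi> i 0 v = (\<lambda>_. 0)"
  by (simp add: free_act_def)

lemma free_act_diff: "free_act \<chi> i (p - q) v = (\<lambda>k. free_act \<chi> i p v k - free_act \<chi> i q v k)"
  using free_act_add[of \<chi> i "p - q" q v] by (simp add: fun_eq_iff)

lemma free_act_minus: "free_act \<chi> i (- p) v = (\<lambda>k. - free_act \<chi> i p v k)"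
  using free_act_diff[of \<chi> i 0 p v] by (simp add: free_act_zero)

lemma free_act_gen_power: "free_act \<chi> i (gen x ^ n) v = (gen_act \<chi> i x ^^ n) v"
  by (induction n) (simp_all add: free_act_one free_act_mult free_act_gen)

definition supported :: "nat \<Rightarrow> (nat \<Rightarrow> 'k::zero) set" where
  "supported i = {v. \<forall>j. j \<notin> basis_set i \<longrightarrow> v j = 0}"

lemma carrier_M3: "carrier (M3 i \<chi>) = supported i"
  by (simp add: M3_def supported_def)

lemma M3_add: "u \<oplus>\<^bsub>M3 i \<chi>\<^esub> v = (\<lambda>k. u k + v k)"
  by (simp add: M3_def)

lemma M3_zero: "\<zero>\<^bsub>M3 i \<chi>\<^esub> = (\<lambda>_. 0)"
  by (simp add: M3_def)

lemma supported_add: "u \<in> supported i \<Longrightarrow> v \<in> supported i \<Longrightarrow> (\<lambda>k. u k + v k :: 'a::monoid_add) \<in> supported i"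
  by (simp add: supported_def)

lemma gen_act_supported: "gen_act \<chi> i x v \<in> supported i"
  unfolding supported_def
proof (intro CollectI allI impI)
  fix k assume "k \<notin> basis_set i"
  then have "gen_basis \<chi> i x j k = 0" if "j \<in> basis_set i" for j
    using that by (cases x) (auto simp: basis_vec_def basis_set_def split: if_splits)
  then show "gen_act \<chi> i x v k = 0" by (simp add: gen_act_def)
qed

lemma foldr_gen_act_supported: "v \<in> supported i \<Longrightarrow> foldr (gen_act \<chi> i) xs v \<in> supported i"
  by (induction xs) (simp_all add: gen_act_supported)

lemma free_act_supported: "v \<in> supported i \<Longrightarrow> free_act \<chi> i p v \<in> supported i"
  using foldr_gen_act_supported[of v i \<chi>] by (simp add: free_act_def supported_def)

lemma gen_act_G1:
  assumes "v \<in> supported i"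
  shows "gen_act \<chi> i G1 v = (\<lambda>k. fst (basis_type \<chi> k) * v k)"
proof
  fix k
  have "finite (basis_set i)" by (simp add: basis_set_def)
  moreover have "gen_act \<chi> i G1 v k = (\<Sum>j\<in>basis_set i. if j = k then fst (basis_type \<chi> k) * v k else 0)"
    unfolding gen_act_def by (rule sum.cong) (auto simp: basis_vec_def)
  ultimately show "gen_act \<chi> i G1 v k = fst (basis_type \<chi> k) * v k"
    using assms by (auto simp: supported_def)
qed

lemma gen_act_G2:
  assumes "v \<in> supported i"
  shows "gen_act \<chi> i G2 v = (\<lambda>k. snd (basis_type \<chi> k) * v k)"
proof
  fix k
  have "finite (basis_set i)" by (simp add: basis_set_def)
  moreover have "gen_act \<chi> i G2 v k = (\<Sum>j\<in>basis_set i. if j = k then snd (basis_type \<chi> k) * v k else 0)"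
    unfolding gen_act_def by (rule sum.cong) (auto simp: basis_vec_def)
  ultimately show "gen_act \<chi> i G2 v k = snd (basis_type \<chi> k) * v k"
    using assms by (auto simp: supported_def)
qed

lemma gen_act_A1:
  assumes "i \<in> {1, 2, 3, 4}"
  shows "gen_act \<chi> i A1 v = (\<lambda>k. if i \<in> {1, 2, 3} \<and> k = 1 then v 2 else if i = 4 \<and> k = 4 then v 3 else 0)"
  using assms by (auto simp: gen_act_def basis_set_def basis_vec_def fun_eq_iff)

lemma gen_act_A2:
  assumes "i \<in> {1, 2, 3, 4}"
  shows "gen_act \<chi> i A2 v = (\<lambda>k. if i = 1 \<and> k = 2 then v 3 else if i = 2 \<and> k = 3 then v 2
    else if i \<in> {3, 4} \<and> k = 1 then v 4 else 0)"
  using assms by (auto simp: gen_act_def basis_set_def basis_vec_def fun_eq_iff)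

lemma gen_act_G1_power:
  assumes "v \<in> supported i"
  shows "(gen_act \<chi> i G1 ^^ n) v = (\<lambda>k. fst (basis_type \<chi> k) ^ n * v k)"
proof -
  have "(gen_act \<chi> i G1 ^^ n) v = (\<lambda>k. fst (basis_type \<chi> k) ^ n * v k) \<and> (gen_act \<chi> i G1 ^^ n) v \<in> supported i"
    by (induction n) (auto simp: assms gen_act_supported gen_act_G1)
  then show ?thesis ..
qed

lemma gen_act_G2_power:
  assumes "v \<in> supported i"
  shows "(gen_act \<chi> i G2 ^^ n) v = (\<lambda>k. snd (basis_type \<chi> k) ^ n * v k)"
proof -
  have "(gen_act \<chi> i G2 ^^ n) v = (\<lambda>k. snd (basis_type \<chi> k) ^ n * v k) \<and> (gen_act \<chi> i G2 ^^ n) v \<in> supported i"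
    by (induction n) (auto simp: assms gen_act_supported gen_act_G2)
  then show ?thesis ..
qed

lemma fst_basis_type: "fst (basis_type \<chi> k) = (if k = 1 \<or> k = 3 then fst \<chi> else - fst \<chi>)"
  and snd_basis_type: "snd (basis_type \<chi> k) = (if k = 1 \<or> k = 2 then snd \<chi> else - snd \<chi>)"
  by (auto simp: basis_type_def wt_bar_def wt_neg_def)

text \<open>The commutation relations hold because each arrow changes the type as its generator
  prescribes. Every square of an odd generator and every alternating word of length four acts by
  zero, so the last three relators reduce to the conditions of \<open>O1_set\<close>.\<close>

lemma relators_act_zero:
  assumes \<chi>: "\<chi> \<in> O1_set N M l1 l2 l3" and i: "i \<in> {1, 2, 3, 4}"
    and r: "r \<in> relators N M l1 l2 l3" and v: "v \<in> supported i"
  shows "free_act \<chi> i r v = (\<lambda>_. 0)"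
proof -
  have O1: "fst \<chi> ^ (2 * N) = 1" "snd \<chi> ^ (2 * M) = 1" "l1 * (1 - fst \<chi> ^ 2) = 0" "l2 * (1 - snd \<chi> ^ 2) = 0"
    "l3 * (1 - fst \<chi> ^ 2 * snd \<chi> ^ 2) - 2 * l1 * l2 * (1 + snd \<chi> ^ 2) * (1 - fst \<chi> ^ 2) = 0"
    using \<chi> by (auto simp: O1_set_def O_set_def)
  note acts = free_act_diff free_act_add free_act_mult free_act_gen free_act_gen_power free_act_one free_act_const
  note G = gen_act_G1_power gen_act_G2_power gen_act_G1 gen_act_G2 gen_act_supported v
  note A = gen_act_A1[OF i] gen_act_A2[OF i] power2_eq_square
  note ty = fst_basis_type snd_basis_type
  have sup: "(\<lambda>k. c k * v k) \<in> supported i" "(\<lambda>k. v k - c k * v k) \<in> supported i" for c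
    using v by (auto simp: supported_def)
  have even: "(- a) ^ (2 * n) = a ^ (2 * n)" for a :: 'a and n
    by (simp add: power_mult)
  consider "r = gen G1 * gen G2 - gen G2 * gen G1" | "r = gen G1 ^ (2 * N) - 1" | "r = gen G2 ^ (2 * M) - 1"
    | "r = gen G1 * gen A1 + gen A1 * gen G1" | "r = gen G1 * gen A2 + gen A2 * gen G1"
    | "r = gen G2 * gen A1 - gen A1 * gen G2" | "r = gen G2 * gen A2 + gen A2 * gen G2"
    | "r = gen A1 ^ 2 - const l1 * (1 - gen G1 ^ 2)"
    | "r = gen A2 ^ 2 - const l2 * (1 - gen G2 ^ 2)"
    | "r = (gen A1 * gen A2 * gen A1 * gen A2 + gen A2 * gen A1 * gen A2 * gen A1)
        - (const l3 * (1 - gen G1 ^ 2 * gen G2 ^ 2) - const (2 * l1 * l2) * (1 + gen G2 ^ 2) * (1 - gen G1 ^ 2))"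
    using r unfolding relators_def Let_def by blast
  then show ?thesis
  proof cases
    case 1
    then show ?thesis by (simp add: acts G sup fun_eq_iff)
  next
    case 2
    then show ?thesis using O1 by (simp add: acts G fun_eq_iff ty even)
  next
    case 3
    then show ?thesis using O1 by (simp add: acts G fun_eq_iff ty even)
  next
    case 4
    then show ?thesis
      by (simp add: acts G fun_eq_iff ty) (use i in \<open>auto simp: A ty\<close>)
  next
    case 5
    then show ?thesis
      by (simp add: acts G fun_eq_iff ty) (use i in \<open>auto simp: A ty\<close>)
  next
    case 6
    then show ?thesis
      by (simp add: acts G fun_eq_iff ty) (use i in \<open>auto simp: A ty\<close>)
  next
    case 7
    then show ?thesis
      by (simp add: acts G fun_eq_iff ty) (use i in \<open>auto simp: A ty\<close>)
  next
    case 8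
    have "gen_act \<chi> i A1 (gen_act \<chi> i A1 v) = (\<lambda>_. 0)"
      using i by (auto simp: A fun_eq_iff)
    moreover have "l1 * (v k - (fst (basis_type \<chi> k))\<^sup>2 * v k) = l1 * (1 - fst \<chi> ^ 2) * v k" for k
      by (simp add: ty algebra_simps)
    ultimately show ?thesis using O1(3) 8
      by (simp only: acts G) (simp add: numeral_2_eq_2)
  next
    case 9
    have "gen_act \<chi> i A2 (gen_act \<chi> i A2 v) = (\<lambda>_. 0)"
      using i by (auto simp: A fun_eq_iff)
    moreover have "l2 * (v k - (snd (basis_type \<chi> k))\<^sup>2 * v k) = l2 * (1 - snd \<chi> ^ 2) * v k" for k
      by (simp add: ty algebra_simps)
    ultimately show ?thesis using O1(4) 9
      by (simp only: acts G) (simp add: numeral_2_eq_2)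
  next
    case 10
    have A1: "gen_act \<chi> i A1 (gen_act \<chi> i A2 (gen_act \<chi> i A1 (gen_act \<chi> i A2 v))) = (\<lambda>_. 0)"
      and A2: "gen_act \<chi> i A2 (gen_act \<chi> i A1 (gen_act \<chi> i A2 (gen_act \<chi> i A1 v))) = (\<lambda>_. 0)"
      using i by (auto simp: A fun_eq_iff)
    have sq: "(fst (basis_type \<chi> k))\<^sup>2 = (fst \<chi>)\<^sup>2" "(snd (basis_type \<chi> k))\<^sup>2 = (snd \<chi>)\<^sup>2" for k
      by (auto simp: ty)
    have "l3 * (v k - (fst \<chi>)\<^sup>2 * ((snd \<chi>)\<^sup>2 * v k)) - 2 * l1 * l2 * (v k - (fst \<chi>)\<^sup>2 * v k + (snd \<chi>)\<^sup>2 * (v k - (fst \<chi>)\<^sup>2 * v k))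
      = (l3 * (1 - fst \<chi> ^ 2 * snd \<chi> ^ 2) - 2 * l1 * l2 * (1 + snd \<chi> ^ 2) * (1 - fst \<chi> ^ 2)) * v k" for k
      by (simp add: algebra_simps)
    then have "l3 * (v k - (fst \<chi>)\<^sup>2 * ((snd \<chi>)\<^sup>2 * v k)) - 2 * l1 * l2 * (v k - (fst \<chi>)\<^sup>2 * v k + (snd \<chi>)\<^sup>2 * (v k - (fst \<chi>)\<^sup>2 * v k)) = 0" for k
      using O1(5) by simp
    then show ?thesis unfolding 10
      by (simp only: acts G A1 A2 sup sq) simp
  qed
qed

text \<open>The annihilator of the module in the free algebra is a two-sided ideal containing the
  relators, hence contains the ideal they generate.\<close>

lemma rel_ideal_act_zero:
  assumes \<chi>: "\<chi> \<in> O1_set N M l1 l2 l3" and i: "i \<in> {1, 2, 3, 4}"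
    and "p \<in> rel_ideal N M l1 l2 l3" and "v \<in> supported i"
  shows "free_act \<chi> i p v = (\<lambda>_. 0)"
proof -
  define I where "I = {p. \<forall>v\<in>supported i. free_act \<chi> i p v = (\<lambda>_. 0)}"
  have z: "free_act \<chi> i q (\<lambda>_. 0) = (\<lambda>_. 0)" for q
    using foldr_gen_act_scale[of \<chi> i _ 0] by (simp add: free_act_def)
  have "ideal I (free_ring :: 'a free ring)"
  proof (rule idealI[OF ring_free_ring])
    show "subgroup I (add_monoid free_ring)"
    proof (rule group.subgroupI)
      show "Group.group (add_monoid (free_ring :: 'a free ring))"
        using abelian_group.a_group[OF ring.is_abelian_group[OF ring_free_ring]] .
      show "I \<noteq> {}" by (auto simp: I_def free_act_zero intro: exI[of _ 0])
      show "inv\<^bsub>add_monoid free_ring\<^esub> a \<in> I" if "a \<in> I" for a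
      proof -
        have "\<ominus>\<^bsub>free_ring\<^esub> a = - a"
          by (rule abelian_group.minus_equality[OF ring.is_abelian_group[OF ring_free_ring]])
            (simp_all add: free_ring_def)
        then show ?thesis using that by (simp add: a_inv_def I_def free_act_minus)
      qed
    qed (auto simp: free_ring_def I_def free_act_add)
  qed (auto simp: I_def free_ring_def free_act_mult free_act_supported z)
  moreover have "relators N M l1 l2 l3 \<subseteq> I"
    using relators_act_zero[OF \<chi> i] by (auto simp: I_def)
  ultimately have "rel_ideal N M l1 l2 l3 \<subseteq> I" by (rule rel_ideal_minimal)
  then have "p \<in> I" using assms(3) by blast
  then show ?thesis using assms(4) by (simp add: I_def)
qed

lemma the_elem_image_eq:
  assumes "a \<in> A" "\<And>b. b \<in> A \<Longrightarrow> f b = c"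
  shows "the_elem (f ` A) = c"
proof -
  have "f ` A = (\<lambda>_. c) ` A" by (rule image_cong[OF refl assms(2)])
  also have "\<dots> = {c}" by (rule image_constant[OF assms(1)])
  finally show ?thesis by simp
qed

lemma cls_self: "p \<in> cls N M l1 l2 l3 p"
  using zero_mem_rel[of N M l1 l2 l3] by (simp add: mem_cls)

lemma M3_smult:
  assumes "\<chi> \<in> O1_set N M l1 l2 l3" "i \<in> {1, 2, 3, 4}" "v \<in> supported i"
  shows "cls N M l1 l2 l3 p \<odot>\<^bsub>M3 i \<chi>\<^esub> v = free_act \<chi> i p v"
proof -
  have eq: "free_act \<chi> i q v = free_act \<chi> i p v" if "q \<in> cls N M l1 l2 l3 p" for q
    using rel_ideal_act_zero[OF assms(1,2) that[unfolded mem_cls] assms(3)]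
    by (simp add: free_act_diff fun_eq_iff)
  then have "the_elem ((\<lambda>q. free_act \<chi> i q v) ` cls N M l1 l2 l3 p) = free_act \<chi> i p v"
    by (rule the_elem_image_eq[OF cls_self])
  then show ?thesis by (simp add: M3_def)
qed

lemma left_module_M3:
  assumes "\<chi> \<in> O1_set N M l1 l2 l3" "i \<in> {1, 2, 3, 4}"
  shows "left_module (H_alg N M l1 l2 l3) (M3 i \<chi>)"
proof (intro left_module.intro left_module_axioms.intro ring_H_alg)
  show "abelian_group (M3 i \<chi>)"
  proof (rule abelian_groupI)
    fix v assume "v \<in> carrier (M3 i \<chi>)"
    then show "\<exists>u\<in>carrier (M3 i \<chi>). u \<oplus>\<^bsub>M3 i \<chi>\<^esub> v = \<zero>\<^bsub>M3 i \<chi>\<^esub>"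
      by (intro bexI[of _ "\<lambda>k. - v k"]) (auto simp: M3_def)
  qed (auto simp: M3_def ac_simps)
next
  let ?H = "H_alg N M l1 l2 l3" and ?V = "M3 i \<chi>"
  note simps = M3_smult[OF assms] M3_add free_act_supported supported_add
    cls_add[symmetric] cls_mult[symmetric] cls_one[symmetric]
    free_act_add free_act_add_right free_act_mult free_act_one
  show "a \<odot>\<^bsub>?V\<^esub> x \<in> carrier ?V" if "a \<in> carrier ?H" "x \<in> carrier ?V" for a x
    using that unfolding carrier_H_alg carrier_M3 by (elim imageE) (simp only: simps)
  show "\<one>\<^bsub>?H\<^esub> \<odot>\<^bsub>?V\<^esub> x = x" if "x \<in> carrier ?V" for x
    using that unfolding carrier_M3 by (simp only: simps)
  show "(a \<oplus>\<^bsub>?H\<^esub> b) \<odot>\<^bsub>?V\<^esub> x = a \<odot>\<^bsub>?V\<^esub> x \<oplus>\<^bsub>?V\<^esub> b \<odot>\<^bsub>?V\<^esub> x"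
    if "a \<in> carrier ?H" "b \<in> carrier ?H" "x \<in> carrier ?V" for a b x
    using that unfolding carrier_H_alg carrier_M3 by (elim imageE) (simp only: simps)
  show "(a \<otimes>\<^bsub>?H\<^esub> b) \<odot>\<^bsub>?V\<^esub> x = a \<odot>\<^bsub>?V\<^esub> (b \<odot>\<^bsub>?V\<^esub> x)"
    if "a \<in> carrier ?H" "b \<in> carrier ?H" "x \<in> carrier ?V" for a b x
    using that unfolding carrier_H_alg carrier_M3 by (elim imageE) (simp only: simps)
  show "a \<odot>\<^bsub>?V\<^esub> (x \<oplus>\<^bsub>?V\<^esub> y) = a \<odot>\<^bsub>?V\<^esub> x \<oplus>\<^bsub>?V\<^esub> a \<odot>\<^bsub>?V\<^esub> y"
    if "a \<in> carrier ?H" "x \<in> carrier ?V" "y \<in> carrier ?V" for a x y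
    using that unfolding carrier_H_alg carrier_M3 by (elim imageE) (simp only: simps)
qed

section \<open>Existence and uniqueness\<close>

text \<open>The elements of the free algebra whose action commutes with \<open>\<phi>\<close> are
  closed under sums and products, so constants and generators suffice.\<close>

lemma module_isoI_generators:
  assumes V: "left_module (H_alg N M l1 l2 l3) V" and W: "left_module (H_alg N M l1 l2 l3) W"
    and bij: "bij_betw \<phi> (carrier V) (carrier W)"
    and add: "\<And>x y. x \<in> carrier V \<Longrightarrow> y \<in> carrier V \<Longrightarrow> \<phi> (x \<oplus>\<^bsub>V\<^esub> y) = \<phi> x \<oplus>\<^bsub>W\<^esub> \<phi> y"
    and sc: "\<And>c x. x \<in> carrier V \<Longrightarrow> \<phi> (scal N M l1 l2 l3 V c x) = scal N M l1 l2 l3 W c (\<phi> x)"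
    and gen: "\<And>g x. x \<in> carrier V \<Longrightarrow>
      \<phi> (cls N M l1 l2 l3 (gen g) \<odot>\<^bsub>V\<^esub> x) = cls N M l1 l2 l3 (gen g) \<odot>\<^bsub>W\<^esub> \<phi> x"
  shows "module_iso (H_alg N M l1 l2 l3) V W"
proof -
  interpret V: H_module N M l1 l2 l3 V by (rule H_module.intro[OF V])
  interpret W: H_module N M l1 l2 l3 W by (rule H_module.intro[OF W])
  have \<phi>: "\<phi> x \<in> carrier W" if "x \<in> carrier V" for x
    using bij that by (auto simp: bij_betw_def)
  have "\<phi> (V.act p x) = W.act p (\<phi> x)" if "x \<in> carrier V" for p x
    using that
  proof (induction p arbitrary: x rule: free_induct)
    case (const c)
    then show ?case using sc by (simp add: V.sc_act W.sc_act)
  next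
    case (gen g)
    then show ?case using assms(6) by (simp add: V.act_def W.act_def)
  next
    case (add p q)
    then show ?case using assms(4) by (simp add: V.act_add W.act_add \<phi>)
  next
    case (mult p q)
    then show ?case by (simp add: V.act_mult W.act_mult \<phi>)
  qed
  then have "\<forall>h\<in>carrier (H_alg N M l1 l2 l3). \<forall>x\<in>carrier V. \<phi> (h \<odot>\<^bsub>V\<^esub> x) = h \<odot>\<^bsub>W\<^esub> \<phi> x"
    by (auto simp: carrier_H_alg V.act_def W.act_def)
  then show ?thesis
    unfolding module_iso_def using V W bij add by blast
qed

lemma module_iso_sym:
  assumes "module_iso R V W"
  shows "module_iso R W V"
proof -
  obtain \<phi> where VW: "left_module R V" "left_module R W" and bij: "bij_betw \<phi> (carrier V) (carrier W)"
    and add: "\<And>x y. x \<in> carrier V \<Longrightarrow> y \<in> carrier V \<Longrightarrow> \<phi> (x \<oplus>\<^bsub>V\<^esub> y) = \<phi> x \<oplus>\<^bsub>W\<^esub> \<phi> y"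
    and lin: "\<And>h x. h \<in> carrier R \<Longrightarrow> x \<in> carrier V \<Longrightarrow> \<phi> (h \<odot>\<^bsub>V\<^esub> x) = h \<odot>\<^bsub>W\<^esub> \<phi> x"
    using assms unfolding module_iso_def by blast
  define \<psi> where "\<psi> = inv_into (carrier V) \<phi>"
  have bij': "bij_betw \<psi> (carrier W) (carrier V)"
    unfolding \<psi>_def by (rule bij_betw_inv_into[OF bij])
  have \<psi>: "\<psi> y \<in> carrier V" "\<phi> (\<psi> y) = y" if "y \<in> carrier W" for y
    using bij bij' that by (auto simp: bij_betw_def \<psi>_def f_inv_into_f)
  have inj: "x = y" if "\<phi> x = \<phi> y" "x \<in> carrier V" "y \<in> carrier V" for x y
    using bij that by (auto simp: bij_betw_def dest: inj_onD)
  interpret V: left_module R V by (rule VW(1))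
  interpret W: left_module R W by (rule VW(2))
  have "\<psi> (x \<oplus>\<^bsub>W\<^esub> y) = \<psi> x \<oplus>\<^bsub>V\<^esub> \<psi> y" if "x \<in> carrier W" "y \<in> carrier W" for x y
    by (rule inj) (use that \<psi> add in auto)
  moreover have "\<psi> (h \<odot>\<^bsub>W\<^esub> x) = h \<odot>\<^bsub>V\<^esub> \<psi> x" if "h \<in> carrier R" "x \<in> carrier W" for h x
    by (rule inj) (use that \<psi> lin V.smult_closed W.smult_closed in auto)
  ultimately show ?thesis
    unfolding module_iso_def using VW bij' by blast
qed

section \<open>Transport of an abstract module to coordinates\<close>

locale H_module_3 = H_module N M l1 l2 l3 V
  for N M :: nat and l1 l2 l3 :: "'k::{alg_closed_field, field_char_0}" and V :: "('k free set, 'v) module" (structure) +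
  fixes \<Lambda> :: "'k ^ 3 \<Rightarrow> 'v"
  assumes bij: "bij_betw \<Lambda> UNIV (carrier V)"
    and \<Lambda>_add: "\<And>u v. \<Lambda> (u + v) = \<Lambda> u \<oplus> \<Lambda> v" and \<Lambda>_scale: "\<And>c v. \<Lambda> (c *s v) = sc c (\<Lambda> v)"
    and N_pos: "N > 0" and M_pos: "M > 0"
    and indecomposable: "indecomposable (H_alg N M l1 l2 l3) V"
begin

text \<open>Defined on the whole free algebra and not only on generators, so that a relator acting
  by zero can be expanded into an identity between operators.\<close>

definition T :: "'k free \<Rightarrow> 'k ^ 3 \<Rightarrow> 'k ^ 3" where
  "T p v = inv_into UNIV \<Lambda> (act p (\<Lambda> v))"

lemma \<Lambda>_closed [simp]: "\<Lambda> v \<in> carrier V"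
  using bij by (auto simp: bij_betw_def)

lemma \<Lambda>_eq_iff: "\<Lambda> u = \<Lambda> v \<longleftrightarrow> u = v"
  using bij by (auto simp: bij_betw_def inj_eq)

lemma \<Lambda>_zero: "\<Lambda> 0 = \<zero>"
  using \<Lambda>_scale[of 0 0] by (simp add: sc_zero)

lemma \<Lambda>_T: "\<Lambda> (T p v) = act p (\<Lambda> v)"
  using bij unfolding T_def by (metis \<Lambda>_closed act_closed bij_betw_imp_surj_on f_inv_into_f)

lemma T_add: "T (p + q) v = T p v + T q v"
  unfolding \<Lambda>_eq_iff[symmetric] \<Lambda>_add \<Lambda>_T by (simp add: act_add)

lemma T_mult: "T (p * q) v = T p (T q v)"
  unfolding \<Lambda>_eq_iff[symmetric] \<Lambda>_T by (simp add: act_mult)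

lemma T_const: "T (const c) v = c *s v"
  unfolding \<Lambda>_eq_iff[symmetric] \<Lambda>_T \<Lambda>_scale by (simp add: sc_act)

lemma T_one: "T 1 v = v"
  using T_const[of 1] by (simp add: const_1)

lemma T_diff: "T (p - q) v = T p v - T q v"
  using T_add[of "p - q" q v] by simp

lemma T_power: "T (p ^ n) v = (T p ^^ n) v"
  by (induction n) (simp_all add: T_one T_mult)

lemma T_add_right: "T p (u + v) = T p u + T p v"
  unfolding \<Lambda>_eq_iff[symmetric] \<Lambda>_add \<Lambda>_T by (simp add: act_add_right)

lemma T_scale: "T p (c *s v) = c *s T p v"
  unfolding \<Lambda>_eq_iff[symmetric] \<Lambda>_scale \<Lambda>_T by (simp add: act_sc)

lemma T_rel: "r \<in> relators N M l1 l2 l3 \<Longrightarrow> T r v = 0"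
  unfolding \<Lambda>_eq_iff[symmetric] \<Lambda>_T \<Lambda>_zero by (simp add: act_rel relators_rel_ideal)

lemma submodule_image:
  assumes "vec.subspace U" "\<And>g u. u \<in> U \<Longrightarrow> T (gen g) u \<in> U"
  shows "submodule (\<Lambda> ` U) (H_alg N M l1 l2 l3) V"
proof (rule submoduleI_gen)
  show "\<Lambda> ` U \<subseteq> carrier V" by auto
  show "\<zero> \<in> \<Lambda> ` U" using vec.subspace_0[OF assms(1)] \<Lambda>_zero by force
  show "x \<oplus> y \<in> \<Lambda> ` U" if "x \<in> \<Lambda> ` U" "y \<in> \<Lambda> ` U" for x y
    using that vec.subspace_add[OF assms(1)] by (auto simp: \<Lambda>_add[symmetric])
  show "sc c x \<in> \<Lambda> ` U" if "x \<in> \<Lambda> ` U" for c x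
    using that vec.subspace_scale[OF assms(1)] by (auto simp: \<Lambda>_scale[symmetric])
  show "act (gen g) x \<in> \<Lambda> ` U" if "x \<in> \<Lambda> ` U" for g x
    using that assms(2) by (auto simp: \<Lambda>_T[symmetric])
qed

lemma rep3_T: "rep3 (\<lambda>g. T (gen g)) N M l1 l2 l3"
proof
  fix g u v c
  show "T (gen g) (u + v) = T (gen g) u + T (gen g) v" by (rule T_add_right)
  show "T (gen g) (c *s v) = c *s T (gen g) v" by (rule T_scale)
  note T_simps = T_add T_mult T_diff T_one T_power T_const
  have "T (gen G1 * gen G2 - gen G2 * gen G1) v = 0" by (rule T_rel) (simp add: relators_def Let_def)
  then show "T (gen G1) (T (gen G2) v) = T (gen G2) (T (gen G1) v)" by (simp add: T_simps)
  have "T (gen G1 ^ (2 * N) - 1) v = 0" by (rule T_rel) (simp add: relators_def Let_def)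
  then show "(T (gen G1) ^^ (2 * N)) v = v" by (simp add: T_simps)
  have "T (gen G2 ^ (2 * M) - 1) v = 0" by (rule T_rel) (simp add: relators_def Let_def)
  then show "(T (gen G2) ^^ (2 * M)) v = v" by (simp add: T_simps)
  have "T (gen G1 * gen A1 + gen A1 * gen G1) v = 0" by (rule T_rel) (simp add: relators_def Let_def)
  then show "T (gen G1) (T (gen A1) v) = - T (gen A1) (T (gen G1) v)" by (simp add: T_simps eq_neg_iff_add_eq_0)
  have "T (gen G1 * gen A2 + gen A2 * gen G1) v = 0" by (rule T_rel) (simp add: relators_def Let_def)
  then show "T (gen G1) (T (gen A2) v) = - T (gen A2) (T (gen G1) v)" by (simp add: T_simps eq_neg_iff_add_eq_0)
  have "T (gen G2 * gen A1 - gen A1 * gen G2) v = 0" by (rule T_rel) (simp add: relators_def Let_def)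
  then show "T (gen G2) (T (gen A1) v) = T (gen A1) (T (gen G2) v)" by (simp add: T_simps)
  have "T (gen G2 * gen A2 + gen A2 * gen G2) v = 0" by (rule T_rel) (simp add: relators_def Let_def)
  then show "T (gen G2) (T (gen A2) v) = - T (gen A2) (T (gen G2) v)" by (simp add: T_simps eq_neg_iff_add_eq_0)
  have "T (gen A1 ^ 2 - const l1 * (1 - gen G1 ^ 2)) v = 0" by (rule T_rel) (simp add: relators_def Let_def)
  then show "T (gen A1) (T (gen A1) v) = l1 *s (v - T (gen G1) (T (gen G1) v))"
    by (simp add: T_simps numeral_2_eq_2)
  have "T (gen A2 ^ 2 - const l2 * (1 - gen G2 ^ 2)) v = 0" by (rule T_rel) (simp add: relators_def Let_def)
  then show "T (gen A2) (T (gen A2) v) = l2 *s (v - T (gen G2) (T (gen G2) v))"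
    by (simp add: T_simps numeral_2_eq_2)
  have "T ((gen A1 * gen A2 * gen A1 * gen A2 + gen A2 * gen A1 * gen A2 * gen A1)
        - (const l3 * (1 - gen G1 ^ 2 * gen G2 ^ 2) - const (2 * l1 * l2) * (1 + gen G2 ^ 2) * (1 - gen G1 ^ 2))) v = 0"
    by (rule T_rel) (simp add: relators_def Let_def)
  moreover have "(T p ^^ 2) u = T p (T p u)" for p u by (simp add: numeral_2_eq_2)
  ultimately show "T (gen A1) (T (gen A2) (T (gen A1) (T (gen A2) v))) + T (gen A2) (T (gen A1) (T (gen A2) (T (gen A1) v))) =
      l3 *s (v - T (gen G1) (T (gen G1) (T (gen G2) (T (gen G2) v))))
      - (2 * l1 * l2) *s (v - T (gen G1) (T (gen G1) v) + T (gen G2) (T (gen G2) (v - T (gen G1) (T (gen G1) v))))"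
    by (simp only: T_simps right_minus_eq)
next
  fix U W :: "('k ^ 3) set"
  assume sub: "vec.subspace U" "vec.subspace W" "\<And>g u. u \<in> U \<Longrightarrow> T (gen g) u \<in> U"
      "\<And>g w. w \<in> W \<Longrightarrow> T (gen g) w \<in> W" and int: "U \<inter> W = {0}" and sum: "\<And>z. \<exists>u\<in>U. \<exists>w\<in>W. z = u + w"
  have "\<Lambda> ` U \<inter> \<Lambda> ` W = {\<zero>}"
  proof -
    have "\<Lambda> ` U \<inter> \<Lambda> ` W = \<Lambda> ` (U \<inter> W)" by (auto simp: \<Lambda>_eq_iff)
    then show ?thesis by (simp add: int \<Lambda>_zero)
  qed
  moreover have "\<Lambda> ` U <+> \<Lambda> ` W = carrier V"
  proof
    show "carrier V \<subseteq> \<Lambda> ` U <+> \<Lambda> ` W"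
    proof
      fix x assume "x \<in> carrier V"
      then obtain z where "x = \<Lambda> z" using bij by (auto simp: bij_betw_def)
      moreover obtain u w where "u \<in> U" "w \<in> W" "z = u + w" using sum by blast
      ultimately show "x \<in> \<Lambda> ` U <+> \<Lambda> ` W"
        unfolding set_add_def' by (auto simp only: \<Lambda>_add)
    qed
  qed (auto simp: set_add_def')
  ultimately have "\<Lambda> ` U = {\<zero>} \<or> \<Lambda> ` W = {\<zero>}"
    using indecomposable submodule_image[OF sub(1,3)] submodule_image[OF sub(2,4)]
    unfolding indecomposable_def by blast
  moreover have "S = {0}" if "\<Lambda> ` S = {\<zero>}" for S
    using inj_image_eq_iff[of \<Lambda> S "{0}"] bij that by (simp add: bij_betw_def \<Lambda>_zero)
  ultimately show "U = {0} \<or> W = {0}" by blast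
qed (rule N_pos M_pos)+

lemma iso_M3: "\<exists>\<chi>\<in>O1_set N M l1 l2 l3. \<exists>i\<in>{1, 2, 3, 4}. module_iso (H_alg N M l1 l2 l3) V (M3 i \<chi>)"
proof -
  obtain \<chi> i e where \<chi>: "\<chi> \<in> O1_set N M l1 l2 l3" and i: "i \<in> {1, 2, 3, 4}"
    and b: "bij_betw (\<lambda>v. \<Sum>j\<in>basis_set i. v j *s e j) (carrier (M3 i \<chi>)) UNIV"
    and e: "\<And>g j. j \<in> basis_set i \<Longrightarrow> T (gen g) (e j) = (\<Sum>k\<in>basis_set i. gen_basis \<chi> i g j k *s e k)"
    using rep3.classification[OF rep3_T] unfolding rep3.classified_def[OF rep3_T] by blast
  define \<Psi> where "\<Psi> v = (\<Sum>j\<in>basis_set i. v j *s e j)" for v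
  have \<Psi>_gen: "\<Psi> (gen_act \<chi> i g v) = T (gen g) (\<Psi> v)" for g v
  proof -
    interpret rep3 "\<lambda>g. T (gen g)" N M l1 l2 l3 by (rule rep3_T)
    have T_sum: "T (gen g) (\<Sum>j\<in>A. f j) = (\<Sum>j\<in>A. T (gen g) (f j))" for A :: "nat set" and f
      by (induction A rule: infinite_finite_induct) (auto simp: T_add_right)
    have "T (gen g) (\<Psi> v) = (\<Sum>j\<in>basis_set i. \<Sum>k\<in>basis_set i. (v j * gen_basis \<chi> i g j k) *s e k)"
      unfolding \<Psi>_def T_sum by (rule sum.cong) (simp_all add: T_scale e vec.scale_sum_right)
    also have "\<dots> = (\<Sum>k\<in>basis_set i. \<Sum>j\<in>basis_set i. (v j * gen_basis \<chi> i g j k) *s e k)"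
      by (rule sum.swap)
    also have "\<dots> = \<Psi> (gen_act \<chi> i g v)"
      unfolding \<Psi>_def gen_act_def by (simp only: vec.scale_sum_left)
    finally show ?thesis by simp
  qed
  \<comment> \<open>The map is explicit in this direction, as linear combinations of the
    \<open>e j\<close>; symmetry gives the other one.\<close>
  have "module_iso (H_alg N M l1 l2 l3) (M3 i \<chi>) V"
  proof (rule module_isoI_generators[OF left_module_M3[OF \<chi> i] left_module_axioms, of "\<Lambda> \<circ> \<Psi>"])
    show "bij_betw (\<Lambda> \<circ> \<Psi>) (carrier (M3 i \<chi>)) (carrier V)"
      using bij_betw_trans[OF b bij] by (simp add: \<Psi>_def[abs_def])
    fix x y g c assume "x \<in> carrier (M3 i \<chi>)"
    then have x: "x \<in> supported i" by (simp add: carrier_M3)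
    show "(\<Lambda> \<circ> \<Psi>) (x \<oplus>\<^bsub>M3 i \<chi>\<^esub> y) = (\<Lambda> \<circ> \<Psi>) x \<oplus> (\<Lambda> \<circ> \<Psi>) y"
      by (simp add: M3_add \<Lambda>_add[symmetric] \<Psi>_def vec.scale_left_distrib sum.distrib)
    show "(\<Lambda> \<circ> \<Psi>) (scal N M l1 l2 l3 (M3 i \<chi>) c x) = sc c ((\<Lambda> \<circ> \<Psi>) x)"
      by (simp add: scal_def[of N M l1 l2 l3 "M3 i \<chi>"] M3_smult[OF \<chi> i x] free_act_const \<Lambda>_scale[symmetric] \<Psi>_def vec.scale_sum_right)
    show "(\<Lambda> \<circ> \<Psi>) (cls N M l1 l2 l3 (gen g) \<odot>\<^bsub>M3 i \<chi>\<^esub> x) = cls N M l1 l2 l3 (gen g) \<odot> (\<Lambda> \<circ> \<Psi>) x"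
      by (simp add: M3_smult[OF \<chi> i x] free_act_gen \<Psi>_gen \<Lambda>_T) (simp add: act_def)
  qed
  then show ?thesis using module_iso_sym \<chi> i by blast
qed

end

text \<open>The images of \<open>a\<^sub>1\<close> and \<open>a\<^sub>2\<close> on \<open>M\<^sub>3\<^sub>,\<^sub>i\<^sup>\<chi>\<close> are lines. The pair of their types determines
  \<open>(\<chi>, i)\<close>.\<close>

fun image_type :: "gen \<Rightarrow> nat \<Rightarrow> 'k::field wt \<Rightarrow> 'k wt" where
  "image_type A1 i \<chi> = (if i = 4 then wt_neg \<chi> else \<chi>)"
| "image_type A2 i \<chi> = (if i = 1 then wt_bar \<chi> else if i = 2 then wt_neg (wt_bar \<chi>) else \<chi>)"
| "image_type _ _ \<chi> = \<chi>"

text \<open>The two types differ by the signs (-,+), (+,-), (+,+), (-,-) for i = 1, 2, 3, 4. These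
  patterns are distinct on nonzero weights, so they give the index, and then either type gives the
  parameter.\<close>

lemma image_type_inj:
  fixes \<chi> \<psi> :: "'k::field_char_0 wt"
  assumes "i \<in> {1, 2, 3, 4}" "j \<in> {1, 2, 3, 4}" and "fst \<chi> \<noteq> 0" "snd \<chi> \<noteq> 0"
    and "image_type A1 i \<chi> = image_type A1 j \<psi>" "image_type A2 i \<chi> = image_type A2 j \<psi>"
  shows "i = j \<and> \<chi> = \<psi>"
proof -
  obtain x y x' y' where xy: "\<chi> = (x, y)" "\<psi> = (x', y')" by (cases \<chi>, cases \<psi>)
  then have "x \<noteq> - x" "y \<noteq> - y" "- x \<noteq> x" "- y \<noteq> y"
    using assms(3,4) eq_neg_self[of x] eq_neg_self[of y] by auto
  then show ?thesis
    using assms(1,2,5,6) unfolding xy wt_neg_def wt_bar_def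
    by (elim insertE emptyE; clarsimp simp: wt_neg_def wt_bar_def)
qed

lemma gen_act_image_type:
  assumes i: "i \<in> {1, 2, 3, 4}" and a: "a \<in> {A1, A2}"
  shows "gen_act \<chi> i G1 (gen_act \<chi> i a v) = (\<lambda>k. fst (image_type a i \<chi>) * gen_act \<chi> i a v k)"
    "gen_act \<chi> i G2 (gen_act \<chi> i a v) = (\<lambda>k. snd (image_type a i \<chi>) * gen_act \<chi> i a v k)"
  unfolding gen_act_G1[OF gen_act_supported] gen_act_G2[OF gen_act_supported]
  using assms by (elim insertE emptyE; simp add: gen_act_A1 gen_act_A2 fst_basis_type snd_basis_type
    wt_neg_def wt_bar_def fun_eq_iff)+

lemma gen_act_nonzero:
  assumes "i \<in> {1, 2, 3, 4}" and "a \<in> {A1, A2}"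
  shows "\<exists>v\<in>supported i. gen_act \<chi> i a v \<noteq> (\<lambda>_. 0)"
proof -
  \<comment> \<open>The source of the only arrow labelled \<open>a\<close>.\<close>
  define j :: nat where "j = (if a = A1 then if i = 4 then 3 else 2 else if i = 1 then 3 else if i = 2 then 2 else 4)"
  have "basis_vec j \<in> supported i"
    using assms by (auto simp: supported_def basis_vec_def basis_set_def j_def)
  moreover have "gen_act \<chi> i a (basis_vec j) \<noteq> (\<lambda>_. 0)"
    using assms by (auto simp: gen_act_A1 gen_act_A2 basis_vec_def j_def fun_eq_iff)
  ultimately show ?thesis by blast
qed

context H_module
begin

text \<open>Formulated on the module itself, so that two isomorphisms onto modules \<open>M3\<close>
  compute the same types. The nonvanishing clause is what makes the type unique.\<close>

definition image_has_type :: "gen \<Rightarrow> 'k wt \<Rightarrow> bool" where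
  "image_has_type a \<tau> \<longleftrightarrow> (\<exists>x\<in>carrier V. act (gen a) x \<noteq> \<zero>) \<and>
    (\<forall>x\<in>carrier V. act (gen G1) (act (gen a) x) = sc (fst \<tau>) (act (gen a) x) \<and>
      act (gen G2) (act (gen a) x) = sc (snd \<tau>) (act (gen a) x))"

lemma image_has_type_unique:
  assumes "image_has_type a \<tau>" "image_has_type a \<tau>'"
  shows "\<tau> = \<tau>'"
proof -
  obtain x where x: "x \<in> carrier V" "act (gen a) x \<noteq> \<zero>"
    using assms(1) by (auto simp: image_has_type_def)
  then show ?thesis
    using assms sc_cancel[OF act_closed[OF x(1)] x(2)]
    by (auto simp: image_has_type_def prod_eq_iff)
qed

lemma iso_M3_image_has_type:
  assumes iso: "module_iso (H_alg N M l1 l2 l3) V (M3 i \<chi>)"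
    and \<chi>: "\<chi> \<in> O1_set N M l1 l2 l3" and i: "i \<in> {1, 2, 3, 4}" and a: "a \<in> {A1, A2}"
  shows "image_has_type a (image_type a i \<chi>)"
proof -
  obtain \<phi> where "bij_betw \<phi> (carrier (M3 i \<chi>)) (carrier V)"
    and lin: "\<And>h x. h \<in> carrier (H_alg N M l1 l2 l3) \<Longrightarrow> x \<in> carrier (M3 i \<chi>) \<Longrightarrow>
      \<phi> (h \<odot>\<^bsub>M3 i \<chi>\<^esub> x) = h \<odot> \<phi> x"
    using module_iso_sym[OF iso] unfolding module_iso_def by blast
  then have img: "\<phi> ` supported i = carrier V" and inj: "inj_on \<phi> (supported i)"
    by (auto simp: bij_betw_def carrier_M3)
  have act: "act p (\<phi> v) = \<phi> (free_act \<chi> i p v)" if "v \<in> supported i" for p v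
    using lin[OF cls_closed, of v p] that by (simp add: act_def M3_smult[OF \<chi> i] carrier_M3)
  have sc: "sc c (\<phi> v) = \<phi> (\<lambda>k. c * v k)" if "v \<in> supported i" for c v
    using act[OF that, of "const c"] by (simp add: sc_act free_act_const)
  have \<phi>: "\<phi> v \<in> carrier V" if "v \<in> supported i" for v using img that by blast
  have zero: "\<phi> (\<lambda>_. 0) = \<zero>"
    using sc[of "\<lambda>_. 0" 0] sc_zero[OF \<phi>, of "\<lambda>_. 0"] by (simp add: supported_def)
  obtain v where v: "v \<in> supported i" "gen_act \<chi> i a v \<noteq> (\<lambda>_. 0)"
    using gen_act_nonzero[OF i a] by blast
  have "act (gen a) (\<phi> v) \<noteq> \<zero>"
  proof
    assume "act (gen a) (\<phi> v) = \<zero>"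
    then have "\<phi> (gen_act \<chi> i a v) = \<phi> (\<lambda>_. 0)"
      by (simp add: act v free_act_gen zero)
    then have "gen_act \<chi> i a v = (\<lambda>_. 0)"
      by (rule inj_onD[OF inj]) (simp_all add: gen_act_supported, simp add: supported_def)
    with v(2) show False ..
  qed
  moreover have "act (gen G1) (act (gen a) x) = sc (fst (image_type a i \<chi>)) (act (gen a) x) \<and>
      act (gen G2) (act (gen a) x) = sc (snd (image_type a i \<chi>)) (act (gen a) x)" if "x \<in> carrier V" for x
  proof -
    from that have "x \<in> \<phi> ` supported i" by (simp only: img)
    then obtain u where u: "u \<in> supported i" "x = \<phi> u" by (elim imageE)
    show ?thesis
      unfolding u(2) act[OF u(1)] free_act_gen act[OF gen_act_supported] sc[OF gen_act_supported]
        gen_act_image_type[OF i a] by (intro conjI refl)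
  qed
  ultimately show ?thesis
    using \<phi>[OF v(1)] unfolding image_has_type_def by blast
qed

end

lemma O_set_nonzero: "\<chi> \<in> O_set N M \<Longrightarrow> N > 0 \<Longrightarrow> M > 0 \<Longrightarrow> fst \<chi> \<noteq> 0 \<and> snd \<chi> \<noteq> 0"
  by (auto simp: O_set_def power_0_left)

lemma O1_set_O_set: "\<chi> \<in> O1_set N M l1 l2 l3 \<Longrightarrow> \<chi> \<in> O_set N M"
  by (auto simp: O1_set_def)

theorem indecomposable_3_classification:
  fixes V :: "('k::{alg_closed_field, field_char_0} free set, 'v) module"
  assumes V: "left_module (H_alg N M l1 l2 l3) V" and "indecomposable (H_alg N M l1 l2 l3) V"
    and "has_dim N M l1 l2 l3 V 3" and "N > 0" "M > 0"
  shows "\<exists>!p. p \<in> O1_set N M l1 l2 l3 \<times> {1, 2, 3, 4} \<and> module_iso (H_alg N M l1 l2 l3) V (M3 (snd p) (fst p))"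
proof -
  interpret H_module N M l1 l2 l3 V by (rule H_module.intro[OF V])
  obtain \<Lambda> :: "'k ^ 3 \<Rightarrow> 'v" where "bij_betw \<Lambda> UNIV (carrier V)"
    "\<And>u v. \<Lambda> (u + v) = \<Lambda> u \<oplus>\<^bsub>V\<^esub> \<Lambda> v" "\<And>c v. \<Lambda> (c *s v) = sc c (\<Lambda> v)"
    by (rule coordinates_3[OF assms(3)]) (rule that)
  then interpret H_module_3 N M l1 l2 l3 V \<Lambda>
    by unfold_locales (use assms in auto)
  obtain \<chi> i where \<chi>: "\<chi> \<in> O1_set N M l1 l2 l3" and i: "i \<in> {1, 2, 3, 4}"
    and iso: "module_iso (H_alg N M l1 l2 l3) V (M3 i \<chi>)"
    using iso_M3 by blast
  have unique: "i = j \<and> \<chi> = \<psi>" if "\<psi> \<in> O1_set N M l1 l2 l3" "j \<in> {1, 2, 3, 4}"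
    "module_iso (H_alg N M l1 l2 l3) V (M3 j \<psi>)" for \<psi> j
  proof (rule image_type_inj[OF i that(2)])
    show "fst \<chi> \<noteq> 0" "snd \<chi> \<noteq> 0"
      using O_set_nonzero[OF O1_set_O_set[OF \<chi>] assms(4,5)] by auto
    show "image_type A1 i \<chi> = image_type A1 j \<psi>" "image_type A2 i \<chi> = image_type A2 j \<psi>"
      using image_has_type_unique iso_M3_image_has_type[OF iso \<chi> i] iso_M3_image_has_type[OF that(3,1,2)]
      by blast+
  qed
  show ?thesis
  proof (rule ex1I[of _ "(\<chi>, i)"])
    show "p = (\<chi>, i)" if "p \<in> O1_set N M l1 l2 l3 \<times> {1, 2, 3, 4} \<and>
        module_iso (H_alg N M l1 l2 l3) V (M3 (snd p) (fst p))" for p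
      using unique[of "fst p" "snd p"] that by (auto simp: prod_eq_iff)
  qed (use \<chi> i iso in simp)
qed

section \<open>Duals\<close>

text \<open>Only one side is assumed to be a module; the axioms on the other side are carried over
  by the bijection. For a dual this avoids a direct proof of the axioms, which would require
  properties of the antipode.\<close>

lemma module_iso_transport:
  assumes W: "left_module R W" and bij: "bij_betw \<Psi> (carrier W) (carrier D)"
    and add: "\<And>x y. x \<in> carrier W \<Longrightarrow> y \<in> carrier W \<Longrightarrow> \<Psi> (x \<oplus>\<^bsub>W\<^esub> y) = \<Psi> x \<oplus>\<^bsub>D\<^esub> \<Psi> y"
    and zero: "\<Psi> \<zero>\<^bsub>W\<^esub> = \<zero>\<^bsub>D\<^esub>"
    and lin: "\<And>h x. h \<in> carrier R \<Longrightarrow> x \<in> carrier W \<Longrightarrow> \<Psi> (h \<odot>\<^bsub>W\<^esub> x) = h \<odot>\<^bsub>D\<^esub> \<Psi> x"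
  shows "module_iso R W D"
proof -
  interpret W: left_module R W by (rule W)
  have img: "carrier D = \<Psi> ` carrier W" using bij by (simp add: bij_betw_def)
  note rev = add[symmetric] zero[symmetric] lin[symmetric]
  have "abelian_group D"
  proof (rule abelian_groupI)
    show "\<zero>\<^bsub>D\<^esub> \<in> carrier D" by (simp add: img rev)
    show "x \<oplus>\<^bsub>D\<^esub> y \<in> carrier D" if "x \<in> carrier D" "y \<in> carrier D" for x y
      using that unfolding img by (elim imageE) (simp add: rev)
    show "x \<oplus>\<^bsub>D\<^esub> y \<oplus>\<^bsub>D\<^esub> z = x \<oplus>\<^bsub>D\<^esub> (y \<oplus>\<^bsub>D\<^esub> z)"
      if "x \<in> carrier D" "y \<in> carrier D" "z \<in> carrier D" for x y z
      using that unfolding img by (elim imageE) (simp add: rev W.a_assoc)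
    show "x \<oplus>\<^bsub>D\<^esub> y = y \<oplus>\<^bsub>D\<^esub> x" if "x \<in> carrier D" "y \<in> carrier D" for x y
      using that unfolding img by (elim imageE) (simp add: rev W.a_comm)
    show "\<zero>\<^bsub>D\<^esub> \<oplus>\<^bsub>D\<^esub> x = x" if "x \<in> carrier D" for x
      using that unfolding img by (elim imageE) (simp add: rev)
    show "\<exists>y\<in>carrier D. y \<oplus>\<^bsub>D\<^esub> x = \<zero>\<^bsub>D\<^esub>" if x: "x \<in> carrier D" for x
    proof -
      obtain u where u: "u \<in> carrier W" "x = \<Psi> u" using x unfolding img by (elim imageE)
      then have "\<Psi> (\<ominus>\<^bsub>W\<^esub> u) \<oplus>\<^bsub>D\<^esub> x = \<zero>\<^bsub>D\<^esub>" by (simp add: rev W.l_neg)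
      then show ?thesis using u by (auto simp: img)
    qed
  qed
  moreover have "left_module_axioms R D"
  proof
    fix a b x y assume "a \<in> carrier R" "x \<in> carrier D"
    then obtain u where a: "a \<in> carrier R" and u: "u \<in> carrier W" "x = \<Psi> u" unfolding img by (elim imageE)
    show "a \<odot>\<^bsub>D\<^esub> x \<in> carrier D" using a u by (simp add: img rev W.smult_closed)
    show "(a \<oplus>\<^bsub>R\<^esub> b) \<odot>\<^bsub>D\<^esub> x = a \<odot>\<^bsub>D\<^esub> x \<oplus>\<^bsub>D\<^esub> b \<odot>\<^bsub>D\<^esub> x" if "b \<in> carrier R"
      using a u that by (simp add: rev W.smult_closed W.smult_l_distr)
    show "(a \<otimes>\<^bsub>R\<^esub> b) \<odot>\<^bsub>D\<^esub> x = a \<odot>\<^bsub>D\<^esub> (b \<odot>\<^bsub>D\<^esub> x)" if "b \<in> carrier R"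
      using a u that by (simp add: rev W.smult_closed W.smult_assoc)
    show "a \<odot>\<^bsub>D\<^esub> (x \<oplus>\<^bsub>D\<^esub> y) = a \<odot>\<^bsub>D\<^esub> x \<oplus>\<^bsub>D\<^esub> a \<odot>\<^bsub>D\<^esub> y" if y: "y \<in> carrier D"
    proof -
      obtain v where "v \<in> carrier W" "y = \<Psi> v" using y unfolding img by (elim imageE)
      then show ?thesis using a u by (simp add: rev W.smult_closed W.smult_r_distr)
    qed
  next
    show "\<one>\<^bsub>R\<^esub> \<odot>\<^bsub>D\<^esub> x = x" if "x \<in> carrier D" for x
      using that unfolding img by (elim imageE) (simp add: rev W.smult_one)
  qed
  ultimately have "left_module R D" by (intro left_module.intro W.ring_axioms)
  then show ?thesis
    unfolding module_iso_def using W bij add lin by blast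
qed

section \<open>The antipode and pairings adjoint to it\<close>

lemma antipode_free_superset:
  assumes "finite S" "Poly_Mapping.keys p \<subseteq> S"
  shows "antipode_free N M p = (\<Sum>w\<in>S. const (Poly_Mapping.lookup p w) * antipode_word N M (letters w))"
  unfolding antipode_free_def using assms
  by (intro sum.mono_neutral_left) (auto simp: in_keys_iff const_0)

lemma antipode_free_single:
  "antipode_free N M (Poly_Mapping.single w c) = const c * antipode_word N M (letters w)"
  by (subst antipode_free_superset[of "{w}"]) auto

lemma antipode_free_add: "antipode_free N M (p + q) = antipode_free N M p + antipode_free N M q"
  using Poly_Mapping.keys_add[of p q]
  by (simp add: antipode_free_superset[of "Poly_Mapping.keys p \<union> Poly_Mapping.keys q"]
    lookup_add const_add distrib_right sum.distrib)

lemma scal_M3: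
  assumes "\<chi> \<in> O1_set N M l1 l2 l3" "i \<in> {1, 2, 3, 4}" "v \<in> supported i"
  shows "scal N M l1 l2 l3 (M3 i \<chi>) c v = (\<lambda>k. c * v k)"
  by (simp add: scal_def M3_smult[OF assms] free_act_const)

lemma supported_scale: "v \<in> supported i \<Longrightarrow> (\<lambda>k. c * v k :: 'a::mult_zero) \<in> supported i"
  by (simp add: supported_def)

text \<open>That the antipode preserves the relations need not be checked: its values act on
  \<open>M\<^sub>3\<^sub>,\<^sub>j\<^sup>\<chi>\<close> as adjoints of the action on \<open>M\<^sub>3\<^sub>,\<^sub>i\<^sup>\<psi>\<close>.\<close>

locale M3_pairing =
  fixes N M :: nat and l1 l2 l3 :: "'k::field" and \<chi> \<psi> :: "'k wt" and i j s1 s2 s3 :: nat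
    and c1 c2 c3 :: 'k and B :: "(nat \<Rightarrow> 'k) \<Rightarrow> (nat \<Rightarrow> 'k) \<Rightarrow> 'k"
  defines "B w v \<equiv> c1 * w s1 * v 1 + c2 * w s2 * v 2 + c3 * w s3 * v 3"
  assumes \<chi>: "\<chi> \<in> O1_set N M l1 l2 l3" and \<psi>: "\<psi> \<in> O1_set N M l1 l2 l3"
    and i: "i \<in> {1, 2, 3, 4}" and j: "j \<in> {1, 2, 3, 4}"
    and basis_i: "basis_set i = {s1, s2, s3}" "distinct [s1, s2, s3]" and basis_j: "basis_set j = {1, 2, 3}"
    and c: "c1 \<noteq> 0" "c2 \<noteq> 0" "c3 \<noteq> 0"
    and adjoint_gen: "\<And>x w v. w \<in> supported i \<Longrightarrow> v \<in> supported j \<Longrightarrow>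
      B (gen_act \<psi> i x w) v = B w (free_act \<chi> j (antipode_gen N M x) v)"
begin

lemma B_linear:
  "B (\<lambda>k. w k + w' k) v = B w v + B w' v" "B (\<lambda>k. a * w k) v = a * B w v"
  "B w (\<lambda>k. v k + v' k) = B w v + B w v'" "B w (\<lambda>k. a * v k) = a * B w v"
  by (simp_all add: B_def algebra_simps)

text \<open>Passing to adjoints reverses products, and so does the antipode on words; the claim for
  generators therefore extends letter by letter.\<close>

lemma adjoint_word:
  assumes "w \<in> supported i" "v \<in> supported j"
  shows "B (foldr (gen_act \<psi> i) xs w) v = B w (free_act \<chi> j (antipode_word N M xs) v)"
  using assms
proof (induction xs arbitrary: v)
  case Nil
  then show ?case by (simp add: free_act_one)
next
  case (Cons x xs)
  then show ?case
    by (simp add: adjoint_gen foldr_gen_act_supported free_act_supported free_act_mult)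
qed

lemma adjoint:
  assumes "w \<in> supported i" "v \<in> supported j"
  shows "B (free_act \<psi> i p w) v = B w (free_act \<chi> j (antipode_free N M p) v)"
proof (induction p rule: free_single_induct)
  case (single u a)
  show ?case
    by (simp add: free_act_single antipode_free_single free_act_mult free_act_const B_linear adjoint_word[OF assms])
next
  case (add p q)
  then show ?case by (simp add: antipode_free_add free_act_add B_linear)
qed

lemma nondegenerate:
  assumes "u \<in> supported j" "v \<in> supported j" "\<And>w. w \<in> supported i \<Longrightarrow> B w u = B w v"
  shows "u = v"
proof -
  have "basis_vec s1 \<in> supported i" "basis_vec s2 \<in> supported i" "basis_vec s3 \<in> supported i"
    using basis_i by (auto simp: supported_def basis_vec_def)
  from assms(3)[OF this(1)] assms(3)[OF this(2)] assms(3)[OF this(3)]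
  have uv: "u 1 = v 1" "u 2 = v 2" "u 3 = v 3"
    using c basis_i(2) by (auto simp: B_def basis_vec_def)
  have "u k = v k" for k
    by (cases "k \<in> {1, 2, 3}") (use uv assms(1,2) basis_j in \<open>auto simp: supported_def\<close>)
  then show ?thesis by blast
qed

lemma antipode_act:
  assumes "v \<in> supported j"
  shows "antipode N M l1 l2 l3 (cls N M l1 l2 l3 p) \<odot>\<^bsub>M3 j \<chi>\<^esub> v = free_act \<chi> j (antipode_free N M p) v"
proof -
  have "the_elem ((\<lambda>q. free_act \<chi> j q v) ` (\<Union>q\<in>cls N M l1 l2 l3 p. cls N M l1 l2 l3 (antipode_free N M q)))
      = free_act \<chi> j (antipode_free N M p) v"
  proof (rule the_elem_image_eq)
    show "antipode_free N M p \<in> (\<Union>q\<in>cls N M l1 l2 l3 p. cls N M l1 l2 l3 (antipode_free N M q))"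
      by (rule UN_I[OF cls_self cls_self])
    fix r assume "r \<in> (\<Union>q\<in>cls N M l1 l2 l3 p. cls N M l1 l2 l3 (antipode_free N M q))"
    then obtain q where q: "q \<in> cls N M l1 l2 l3 p" and r: "r \<in> cls N M l1 l2 l3 (antipode_free N M q)"
      by blast
    have "free_act \<chi> j r v = free_act \<chi> j (antipode_free N M q) v"
      using rel_ideal_act_zero[OF \<chi> j r[unfolded mem_cls] assms]
      by (simp add: free_act_diff fun_eq_iff)
    also have "\<dots> = free_act \<chi> j (antipode_free N M p) v"
    \<comment> \<open>Two representatives of a class act equally on \<open>M3 i \<psi>\<close>.
      Adjointness turns this into equality of the pairings with the two antipodes, and nondegeneracy
      removes the pairing.\<close>
    proof (rule nondegenerate)
      fix w :: "nat \<Rightarrow> 'k" assume w: "w \<in> supported i"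
      have "free_act \<psi> i q w = free_act \<psi> i p w"
        using rel_ideal_act_zero[OF \<psi> i q[unfolded mem_cls] w]
        by (simp add: free_act_diff fun_eq_iff)
      then show "B w (free_act \<chi> j (antipode_free N M q) v) = B w (free_act \<chi> j (antipode_free N M p) v)"
        by (simp add: adjoint[OF w assms, symmetric])
    qed (simp_all add: assms free_act_supported)
    finally show "free_act \<chi> j r v = free_act \<chi> j (antipode_free N M p) v" .
  qed
  then show ?thesis by (simp add: M3_def antipode_def)
qed

lemma functional_expand:
  assumes f: "f \<in> carrier (dual N M l1 l2 l3 (M3 j \<chi>))" and v: "v \<in> supported j"
  shows "f v = v 1 * f (basis_vec 1) + v 2 * f (basis_vec 2) + v 3 * f (basis_vec 3)"
proof -
  have e: "basis_vec k \<in> supported j" if "k \<in> {1, 2, 3}" for k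
    using that basis_j by (auto simp: supported_def basis_vec_def)
  have add: "f (\<lambda>k. x k + y k) = f x + f y" if "x \<in> supported j" "y \<in> supported j" for x y
    using f that by (simp add: dual_def carrier_M3 M3_add)
  have "f (scal N M l1 l2 l3 (M3 j \<chi>) a x) = a * f x" if "x \<in> supported j" for a x
    using f that by (simp add: dual_def carrier_M3)
  then have sc: "f (\<lambda>k. a * x k) = a * f x" if "x \<in> supported j" for a x
    using that by (simp only: scal_M3[OF \<chi> j])
  have "v = (\<lambda>k. (v 1 * basis_vec 1 k + v 2 * basis_vec 2 k) + v 3 * basis_vec 3 k)"
    using v basis_j by (fastforce simp: fun_eq_iff basis_vec_def supported_def)
  then have "f v = f (\<lambda>k. (v 1 * basis_vec 1 k + v 2 * basis_vec 2 k) + v 3 * basis_vec 3 k)" by simp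
  also have "\<dots> = v 1 * f (basis_vec 1) + v 2 * f (basis_vec 2) + v 3 * f (basis_vec 3)"
    by (simp add: add sc e supported_add supported_scale)
  finally show ?thesis .
qed

theorem dual_iso: "module_iso (H_alg N M l1 l2 l3) (dual N M l1 l2 l3 (M3 j \<chi>)) (M3 i \<psi>)"
proof -
  let ?D = "dual N M l1 l2 l3 (M3 j \<chi>)"
  define \<Psi> where "\<Psi> w = (\<lambda>v\<in>supported j. B w v)" for w
  \<comment> \<open>The map leaves the side already known to be a module and sends a vector to
    pairing with it.\<close>
  have "module_iso (H_alg N M l1 l2 l3) (M3 i \<psi>) ?D"
  proof (rule module_iso_transport[OF left_module_M3[OF \<psi> i], of \<Psi>])
    have \<Psi>_in: "\<Psi> w \<in> carrier ?D" for w
      by (auto simp: dual_def \<Psi>_def carrier_M3 M3_add scal_M3[OF \<chi> j] supported_add supported_scale B_linear)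
    show "bij_betw \<Psi> (carrier (M3 i \<psi>)) (carrier ?D)"
      unfolding carrier_M3 bij_betw_def
    proof (intro conjI inj_onI equalityI)
      fix w w' assume w: "w \<in> supported i" "w' \<in> supported i" and eq: "\<Psi> w = \<Psi> w'"
      have e: "basis_vec 1 \<in> supported j" "basis_vec 2 \<in> supported j" "basis_vec 3 \<in> supported j"
        using basis_j by (auto simp: supported_def basis_vec_def)
      have "B w v = B w' v" if "v \<in> supported j" for v
        using fun_cong[OF eq, of v] that by (simp add: \<Psi>_def)
      from this[OF e(1)] this[OF e(2)] this[OF e(3)]
      have "w s1 = w' s1" "w s2 = w' s2" "w s3 = w' s3"
        using c by (auto simp: B_def basis_vec_def)
      then show "w = w'"
        using w basis_i by (fastforce simp: supported_def fun_eq_iff)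
    next
      show "carrier ?D \<subseteq> \<Psi> ` supported i"
      proof
        fix f assume f: "f \<in> carrier ?D"
        define w where "w k = (if k = s1 then f (basis_vec 1) / c1 else if k = s2 then f (basis_vec 2) / c2
          else if k = s3 then f (basis_vec 3) / c3 else 0)" for k
        have "f \<in> extensional (supported j)" using f by (simp add: dual_def carrier_M3)
        moreover have "f v = B w v" if "v \<in> supported j" for v
          unfolding functional_expand[OF f that] using c basis_i(2) by (auto simp: B_def w_def)
        ultimately have "f = \<Psi> w"
          by (auto simp: \<Psi>_def fun_eq_iff extensional_def)
        moreover have "w \<in> supported i" using basis_i(1) by (auto simp: supported_def w_def)
        ultimately show "f \<in> \<Psi> ` supported i" by blast
      qed
    qed (use \<Psi>_in in blast)
    show "\<Psi> (w \<oplus>\<^bsub>M3 i \<psi>\<^esub> w') = \<Psi> w \<oplus>\<^bsub>?D\<^esub> \<Psi> w'" for w w'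
      by (auto simp: dual_def \<Psi>_def M3_add carrier_M3 B_linear fun_eq_iff)
    show "\<Psi> \<zero>\<^bsub>M3 i \<psi>\<^esub> = \<zero>\<^bsub>?D\<^esub>"
      by (auto simp: dual_def \<Psi>_def M3_zero carrier_M3 B_def fun_eq_iff)
    fix h w assume "h \<in> carrier (H_alg N M l1 l2 l3)" "w \<in> carrier (M3 i \<psi>)"
    then obtain p where h: "h = cls N M l1 l2 l3 p" and w: "w \<in> supported i"
      unfolding carrier_H_alg carrier_M3 by (elim imageE)
    have "B (h \<odot>\<^bsub>M3 i \<psi>\<^esub> w) v = \<Psi> w (antipode N M l1 l2 l3 h \<odot>\<^bsub>M3 j \<chi>\<^esub> v)" if "v \<in> supported j" for v
      unfolding h M3_smult[OF \<psi> i w] antipode_act[OF that] adjoint[OF w that]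
      by (simp add: \<Psi>_def free_act_supported that)
    then show "\<Psi> (h \<odot>\<^bsub>M3 i \<psi>\<^esub> w) = h \<odot>\<^bsub>?D\<^esub> \<Psi> w"
      by (subst \<Psi>_def) (simp add: dual_def carrier_M3 restrict_def fun_eq_iff)
  qed
  then show ?thesis by (rule module_iso_sym)
qed

end

section \<open>Identification of the two duals\<close>

lemma wt_inv_O1:
  assumes "\<chi> \<in> O1_set N M l1 l2 l3" "N > 0" "M > 0"
  shows "(inverse (fst \<chi>), inverse (snd \<chi>)) \<in> O1_set N M l1 l2 l3"
proof -
  obtain x y where xy: "\<chi> = (x, y)" by (cases \<chi>)
  have nz: "x \<noteq> 0" "y \<noteq> 0"
    using O_set_nonzero[OF O1_set_O_set[OF assms(1)] assms(2,3)] by (simp_all add: xy)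
  have l: "l1 * (1 - x\<^sup>2) = 0" "l2 * (1 - y\<^sup>2) = 0"
    and "l3 * (1 - x\<^sup>2 * y\<^sup>2) - 2 * l1 * l2 * (1 + y\<^sup>2) * (1 - x\<^sup>2) = 0"
    and pow: "x ^ (2 * N) = 1" "y ^ (2 * M) = 1"
    using assms(1) by (auto simp: xy O1_set_def O_set_def)
  \<comment> \<open>The term with 2 l1 l2 contains l1 (1 - x^2), which vanishes already. Each
    remaining condition says that a constant is zero or a square is 1, and so survives
    inversion.\<close>
  then have "l3 * (1 - x\<^sup>2 * y\<^sup>2) = 0" by auto
  moreover have inv: "1 - inverse a ^ 2 = 0 \<longleftrightarrow> 1 - a ^ 2 = 0" if "a \<noteq> 0" for a :: 'a
    using that by (simp add: power_inverse)
  moreover have "(1 - inverse x ^ 2 * inverse y ^ 2 = 0) = (1 - x\<^sup>2 * y\<^sup>2 = 0)"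
    using inv[of "x * y"] nz by (simp only: inverse_mult_distrib power_mult_distrib) simp
  ultimately show ?thesis
    using l pow inv[OF nz(1)] inv[OF nz(2)] nz
    by (auto simp: xy O1_set_def O_set_def power_inverse)
qed

lemma free_act_antipode_gen:
  "v \<in> supported j \<Longrightarrow> free_act \<chi> j (antipode_gen N M G1) v = (\<lambda>k. fst (basis_type \<chi> k) ^ (2 * N - 1) * v k)"
  "v \<in> supported j \<Longrightarrow> free_act \<chi> j (antipode_gen N M G2) v = (\<lambda>k. snd (basis_type \<chi> k) ^ (2 * M - 1) * v k)"
  "free_act \<chi> j (antipode_gen N M A1) v = (\<lambda>k. - (fst (basis_type \<chi> k) ^ (2 * N - 1) * gen_act \<chi> j A1 v k))"
  "free_act \<chi> j (antipode_gen N M A2) v = (\<lambda>k. - (snd (basis_type \<chi> k) ^ (2 * M - 1) * gen_act \<chi> j A2 v k))"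
  by (simp_all add: free_act_minus free_act_mult free_act_gen_power free_act_gen gen_act_supported
    gen_act_G1_power gen_act_G2_power)

text \<open>The basis dual to e1, e2, e3 takes the roles of e3, e4, e1 in the first case and of e2,
  e1, e4 in the second. The parameters are thus the inverses of the types of e3 and of e2
  respectively.\<close>

theorem dual_M3:
  fixes \<chi> :: "'k::{alg_closed_field, field_char_0} wt"
  assumes \<chi>: "\<chi> \<in> O1_set N M l1 l2 l3" and "N > 0" "M > 0"
  shows "module_iso (H_alg N M l1 l2 l3) (dual N M l1 l2 l3 (M3 1 \<chi>)) (M3 4 (wt_neg (wt_bar (wt_inv \<chi>))))"
    and "module_iso (H_alg N M l1 l2 l3) (dual N M l1 l2 l3 (M3 2 \<chi>)) (M3 3 (wt_bar (wt_inv \<chi>)))"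
proof -
  obtain x y where xy: "\<chi> = (x, y)" by (cases \<chi>)
  have nz: "x \<noteq> 0" "y \<noteq> 0"
    using O_set_nonzero[OF O1_set_O_set[OF \<chi>] assms(2,3)] by (simp_all add: xy)
  have inv: "(inverse x, inverse y) \<in> O1_set N M l1 l2 l3"
    using wt_inv_O1[OF assms] by (simp add: xy)
  have pow: "x ^ (2 * N) = 1" "y ^ (2 * M) = 1"
    using \<chi> by (auto simp: xy O1_set_def O_set_def)
  \<comment> \<open>The antipode writes the inverse of a group generator as its power with exponent
    one less than twice \<open>n\<close>.\<close>
  have pow_pred: "a ^ (2 * n - 1) = inverse a" if "a ^ (2 * n) = 1" "n > 0" for a :: 'k and n
  proof -
    have "a * a ^ (2 * n - 1) = 1" using that by (simp add: power_eq_if)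
    then show ?thesis by (simp add: inverse_unique)
  qed
  have pows: "x ^ (2 * N - 1) = inverse x" "(- x) ^ (2 * N - 1) = - inverse x"
    "y ^ (2 * M - 1) = inverse y" "(- y) ^ (2 * M - 1) = - inverse y"
    using pow_pred[of x N] pow_pred[of "- x" N] pow_pred[of y M] pow_pred[of "- y" M] pow assms(2,3)
    by (simp_all add: power_mult)
  note adj = free_act_antipode_gen gen_act_G1 gen_act_G2 fst_basis_type snd_basis_type
  \<comment> \<open>With the pairing of e3 and e1 set to 1, adjointness for a1 with S(a1) = -g1^-1
    a1 forces -1/x for e4 and e2; then a2 multiplies by -1/y and gives 1/(xy) for e1 and e3.\<close>
  have "M3_pairing N M l1 l2 l3 \<chi> (inverse x, - inverse y) 4 1 3 4 1 1 (- inverse x) (inverse x * inverse y)"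
  proof (unfold_locales, goal_cases)
    case 1
    show ?case by (rule \<chi>)
  next
    case 2
    show ?case by (rule O1_setI[OF inv]) auto
  next
    \<comment> \<open>This goal is \<open>adjoint_gen\<close>, one identity for each
      generator.\<close>
    case (11 g w v)
    then show ?case
      by (cases g) (use nz in \<open>simp_all add: adj pows xy gen_act_A1 gen_act_A2 del: One_nat_def antipode_gen.simps\<close>)
  qed (use nz in \<open>auto simp: basis_set_def\<close>)
  then show "module_iso (H_alg N M l1 l2 l3) (dual N M l1 l2 l3 (M3 1 \<chi>)) (M3 4 (wt_neg (wt_bar (wt_inv \<chi>))))"
    using M3_pairing.dual_iso by (auto simp: xy wt_neg_def wt_bar_def wt_inv_def)
  \<comment> \<open>Here the sink e1 is paired with the source e2 by the constant 1. The two arrows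
    then determine -x for e2 and e1, and y for e4 and e3, the sign lost because e3 has second weight
    -y.\<close>
  have "M3_pairing N M l1 l2 l3 \<chi> (- inverse x, inverse y) 3 2 2 1 4 (- x) 1 y"
  proof (unfold_locales, goal_cases)
    case 1
    show ?case by (rule \<chi>)
  next
    case 2
    show ?case by (rule O1_setI[OF inv]) auto
  next
    case (11 g w v)
    then show ?case
      by (cases g) (use nz in \<open>simp_all add: adj pows xy gen_act_A1 gen_act_A2 del: One_nat_def antipode_gen.simps\<close>)
  qed (use nz in \<open>auto simp: basis_set_def\<close>)
  then show "module_iso (H_alg N M l1 l2 l3) (dual N M l1 l2 l3 (M3 2 \<chi>)) (M3 3 (wt_bar (wt_inv \<chi>)))"
    using M3_pairing.dual_iso by (auto simp: xy wt_neg_def wt_bar_def wt_inv_def)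
qed

theorem lemma6p5:
  fixes N M :: nat
    and l1 l2 l3 :: "'k :: {alg_closed_field, field_char_0}"
    and V :: "('k free set, 'v) module"
  assumes "N \<ge> 2" and "M \<ge> 2"
  shows "(left_module (H_alg N M l1 l2 l3) V \<and> indecomposable (H_alg N M l1 l2 l3) V \<and>
            has_dim N M l1 l2 l3 V 3
          \<longrightarrow> (\<exists>!p. p \<in> O1_set N M l1 l2 l3 \<times> {1, 2, 3, 4} \<and>
                module_iso (H_alg N M l1 l2 l3) V (M3 (snd p) (fst p))))
       \<and> (\<forall>\<chi>\<in>O1_set N M l1 l2 l3.
            module_iso (H_alg N M l1 l2 l3)
              (dual N M l1 l2 l3 (M3 1 \<chi>)) (M3 4 (wt_neg (wt_bar (wt_inv \<chi>)))) \<and>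
            module_iso (H_alg N M l1 l2 l3)
              (dual N M l1 l2 l3 (M3 2 \<chi>)) (M3 3 (wt_bar (wt_inv \<chi>))))"
proof (intro conjI impI ballI)
  have pos: "N > 0" "M > 0" using assms by auto
  assume "left_module (H_alg N M l1 l2 l3) V \<and> indecomposable (H_alg N M l1 l2 l3) V \<and>
    has_dim N M l1 l2 l3 V 3"
  then show "\<exists>!p. p \<in> O1_set N M l1 l2 l3 \<times> {1, 2, 3, 4} \<and>
      module_iso (H_alg N M l1 l2 l3) V (M3 (snd p) (fst p))"
    by (elim conjE) (rule indecomposable_3_classification[OF _ _ _ pos])
qed (rule dual_M3; use assms in simp)+

end
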